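(* Let $x^\dagger\in\operatorname{int}(\mathcal D(F))$ be a solution of $F(x)=y$, and suppose that for some $a>0$ and constants $0<c_a\le C_a<\infty$ $$c_a\|x-x^\dagger\|_{-a}\le \|F(x)-F(x^\dagger)\|_Y\le C_a\|x-x^\dagger\|_{-a}\qquad\text{for all } x\in\mathcal D=\mathcal D(F)\cap\mathcal D(B).$$ Let $\psi$ be an index function such that $\psi^{2a+2}$ is sub-linear, and suppose that $x^\dagger-\overline x=\psi(G)w$ for some $w\in X$, where $G:=B^{-(2a+2)}$. Then there is a constant $c_1>0$ (depending on $w$, but not on $\alpha$, $\delta$ or $y^\delta$) such that for all $\alpha>0$, all $\delta\ge 0$ and all $y^\delta\in Y$ with $\|y-y^\delta\|_Y\le\delta$, every minimizer $x_\alpha^\delta$ of the Tikhonov functional $T_\alpha^\delta$ over $\mathcal D$ satisfies $$\|x_\alpha^\delta-x^\dagger\|_X\le c_1\,\psi(\alpha)+\frac{\delta}{\lambda(\alpha)},\qquad \lambda(\alpha)=\frac{1}{K_2}\,\alpha^{a/(2a+2)},\quad K_2=\max\{1,\tfrac{2}{c_a}\}.$$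
   Context: $X,Y$ are separable infinite-dimensional Hilbert spaces. $F:\mathcal D(F)\subseteq X\to Y$ is a (possibly nonlinear) weakly sequentially continuous operator whose domain $\mathcal D(F)$ is convex and closed in $X$. $x^\dagger\in\mathcal D(F)$ and $y=F(x^\dagger)$. $B:\mathcal D(B)\subset X\to X$ is a densely defined, unbounded, self-adjoint linear operator with $\|Bx\|_X\ge\underline m\|x\|_X$ for all $x\in\mathcal D(B)$, for some $\underline m>0$. It generates the Hilbert scale $X_\tau=\mathcal D(B^\tau)$ for $\tau>0$, $X_\tau=X$ for $\tau\le0$, with $\|x\|_\tau:=\|B^\tau x\|_X$ for $\tau\in\mathbb R$. Tikhonov functional: $T_\alpha^\delta(x):=\|F(x)-y^\delta\|_Y^2+\alpha\|B(x-\overline x)\|_X^2$ for $x\in\mathcal D:=\mathcal D(F)\cap\mathcal D(B)$, where $\overline x\in\mathcal D$ is a fixed initial guess. It is not assumed that $x^\dagger\in\mathcal D(B)$. An index function is a continuous non-decreasing function $\varphi:(0,\infty)\to(0,\infty)$ with $\lim_{t\to+0}\varphi(t)=0$. It is sub-linear if there is $t_0>0$ such that $t\mapsto t/\varphi(t)$ is non-decreasing on $(0,t_0]$. The operator $\psi(G)$ is defined by spectral calculus for the bounded injective self-adjoint positive operator $G=B^{-(2a+2)}$. *)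

theory Defs
  imports "HOL-Analysis.Analysis"
begin

section \<open>Hilbert spaces\<close>

text \<open>
  Hilbert spaces are real: types of sort \<open>{real_inner, complete_space}\<close>. A complex Hilbert space
  is covered through its underlying real space with inner product \<open>Re \<langle>x, y\<rangle>\<close>; all
  notions below are unchanged under this passage.
\<close>

definition infinite_dimensional :: "'a::real_vector itself \<Rightarrow> bool" where
  "infinite_dimensional _ \<longleftrightarrow> \<not> (\<exists>S :: 'a set. finite S \<and> span S = UNIV)"

definition weakly_converges :: "(nat \<Rightarrow> 'a::real_inner) \<Rightarrow> 'a \<Rightarrow> bool" where
  "weakly_converges u l \<longleftrightarrow> (\<forall>v. (\<lambda>n. u n \<bullet> v) \<longlonglongrightarrow> l \<bullet> v)"

definition weakly_seq_continuous_on ::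
    "'a::real_inner set \<Rightarrow> ('a \<Rightarrow> 'b::real_inner) \<Rightarrow> bool" where
  "weakly_seq_continuous_on D F \<longleftrightarrow>
     (\<forall>u l. (\<forall>n. u n \<in> D) \<and> l \<in> D \<and> weakly_converges u l
            \<longrightarrow> weakly_converges (\<lambda>n. F (u n)) (F l))"


section \<open>Unbounded self-adjoint operators\<close>

text \<open>
  A partially defined operator is a pair of its domain \<open>D\<close> and a function \<open>B\<close>, whose values
  outside \<open>D\<close> are irrelevant.
\<close>

definition densely_defined_linear ::
    "'a::real_normed_vector set \<Rightarrow> ('a \<Rightarrow> 'a) \<Rightarrow> bool" where
  "densely_defined_linear D B \<longleftrightarrow>
     subspace D \<and> closure D = UNIV \<and>
     (\<forall>x\<in>D. \<forall>y\<in>D. B (x + y) = B x + B y) \<and>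
     (\<forall>c. \<forall>x\<in>D. B (c *\<^sub>R x) = c *\<^sub>R B x)"

text \<open>
  The right-hand side of the equivalence says that \<open>y\<close> lies in the domain of the adjoint and is
  mapped to \<open>z\<close> by it, so the condition is equality of the graphs of \<open>B\<close> and of its adjoint.
\<close>

definition self_adjoint_on :: "'a::real_inner set \<Rightarrow> ('a \<Rightarrow> 'a) \<Rightarrow> bool" where
  "self_adjoint_on D B \<longleftrightarrow>
     densely_defined_linear D B \<and>
     (\<forall>y z. (y \<in> D \<and> B y = z) \<longleftrightarrow> (\<forall>x\<in>D. B x \<bullet> y = x \<bullet> z))"

definition unbounded_on :: "'a::real_normed_vector set \<Rightarrow> ('a \<Rightarrow> 'a) \<Rightarrow> bool" where
  "unbounded_on D B \<longleftrightarrow> \<not> (\<exists>M. \<forall>x\<in>D. norm (B x) \<le> M * norm x)"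

text \<open>
  If \<open>B\<close> is self-adjoint and bounded below, then it is a bijection of \<open>D\<close> onto the whole space with
  bounded inverse, and the following is this inverse.
\<close>

definition inverse_operator ::
    "'a::real_normed_vector set \<Rightarrow> ('a \<Rightarrow> 'a) \<Rightarrow> 'a \<Rightarrow>\<^sub>L 'a" where
  "inverse_operator D B = Blinfun (inv_into D B)"


section \<open>Spectral calculus of bounded self-adjoint operators\<close>

definition poly_operator ::
    "real poly \<Rightarrow> ('a::real_normed_vector \<Rightarrow>\<^sub>L 'a) \<Rightarrow> 'a \<Rightarrow>\<^sub>L 'a" where
  "poly_operator p A = (\<Sum>i\<le>degree p. coeff p i *\<^sub>R ((\<lambda>T. A o\<^sub>L T) ^^ i) id_blinfun)"

text \<open>
  For \<open>A\<close> bounded self-adjoint and \<open>f\<close> continuous on \<open>[-\<parallel>A\<parallel>, \<parallel>A\<parallel>]\<close>, an interval that contains the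
  spectrum of \<open>A\<close>, the operator \<open>f(A)\<close> is the limit in operator norm of \<open>p\<^sub>n(A)\<close> for polynomials
  \<open>p\<^sub>n\<close> converging to \<open>f\<close> uniformly on this interval. Such polynomials exist by the Weierstrass
  theorem, and since \<open>\<parallel>p(A)\<parallel> \<le> sup |p|\<close> the limit exists and does not depend on their choice.
\<close>

definition spectral_calculus ::
    "(real \<Rightarrow> real) \<Rightarrow> ('a::real_normed_vector \<Rightarrow>\<^sub>L 'a) \<Rightarrow> 'a \<Rightarrow>\<^sub>L 'a" where
  "spectral_calculus f A =
     (THE T. \<exists>p :: nat \<Rightarrow> real poly.
        uniform_limit {- norm A..norm A} (\<lambda>n. poly (p n)) f sequentially \<and>
        (\<lambda>n. poly_operator (p n) A) \<longlonglongrightarrow> T)"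

text \<open>
  The operator \<open>B\<^bsup>-s\<^esup>\<close> for \<open>s > 0\<close>, i.e. the function \<open>\<lambda> \<mapsto> \<lambda>\<^bsup>-s\<^esup>\<close> of \<open>B\<close>, expressed as the
  function \<open>t \<mapsto> t\<^bsup>s\<^esup>\<close> of \<open>B\<^bsup>-1\<^esup>\<close>. The absolute value has no effect if \<open>B\<close> is positive. For an
  indefinite \<open>B\<close>, real powers are read as powers of \<open>|B|\<close>, which is the reading under which
  \<open>B\<^bsup>-s\<^esup>\<close> is always defined, positive and injective.
\<close>

definition negative_power ::
    "'a::real_normed_vector set \<Rightarrow> ('a \<Rightarrow> 'a) \<Rightarrow> real \<Rightarrow> 'a \<Rightarrow>\<^sub>L 'a" where
  "negative_power D B s = spectral_calculus (\<lambda>t. \<bar>t\<bar> powr s) (inverse_operator D B)"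

text \<open>The norm \<open>\<parallel>x\<parallel>\<^bsub>-s\<^esub>\<close> of the Hilbert scale generated by \<open>B\<close>, for \<open>s > 0\<close>.\<close>

definition negative_norm ::
    "'a::real_normed_vector set \<Rightarrow> ('a \<Rightarrow> 'a) \<Rightarrow> real \<Rightarrow> 'a \<Rightarrow> real" where
  "negative_norm D B s x = norm (negative_power D B s x)"


section \<open>Index functions\<close>

text \<open>Only the values of the functions on \<open>(0,\<infinity>)\<close> matter.\<close>

definition index_function :: "(real \<Rightarrow> real) \<Rightarrow> bool" where
  "index_function \<phi> \<longleftrightarrow>
     (\<forall>t>0. \<phi> t > 0) \<and> continuous_on {0<..} \<phi> \<and> mono_on {0<..} \<phi> \<and>
     (\<phi> \<longlongrightarrow> 0) (at_right 0)"

definition sub_linear :: "(real \<Rightarrow> real) \<Rightarrow> bool" where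
  "sub_linear \<phi> \<longleftrightarrow> (\<exists>t0>0. mono_on {0<..t0} (\<lambda>t. t / \<phi> t))"

text \<open>
  The operator \<open>\<psi>(G)\<close> for a positive operator \<open>G\<close>. The extension of \<open>\<psi>\<close> by \<open>0\<close> is continuous on the
  real line; its value at \<open>0\<close> is the limit of \<open>\<psi>\<close>, and the negative reals do not meet the spectrum.
\<close>

definition index_operator ::
    "(real \<Rightarrow> real) \<Rightarrow> ('a::real_normed_vector \<Rightarrow>\<^sub>L 'a) \<Rightarrow> 'a \<Rightarrow>\<^sub>L 'a" where
  "index_operator \<psi> G = spectral_calculus (\<lambda>t. if 0 < t then \<psi> t else 0) G"


section \<open>Tikhonov regularization\<close>

definition tikhonov ::
    "('a::real_normed_vector \<Rightarrow> 'b::real_normed_vector) \<Rightarrow> ('a \<Rightarrow> 'a) \<Rightarrow> 'a \<Rightarrow> real \<Rightarrow> 'b \<Rightarrow> 'a \<Rightarrow> real"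
  where "tikhonov F B xbar \<alpha> yd x = (norm (F x - yd))\<^sup>2 + \<alpha> * (norm (B (x - xbar)))\<^sup>2"

definition is_minimizer_on :: "'a set \<Rightarrow> ('a \<Rightarrow> real) \<Rightarrow> 'a \<Rightarrow> bool" where
  "is_minimizer_on D T x \<longleftrightarrow> x \<in> D \<and> (\<forall>z\<in>D. T x \<le> T z)"

end

theory Submission
  imports Defs "HOL-Computational_Algebra.Fundamental_Theorem_Algebra"
begin

text \<open>
  With \<open>A = B\<^sup>-\<^sup>1\<close>, which is bounded and symmetric, every operator in the statement is a continuous
  function of \<open>A\<close>. The calculus rests on \<open>\<parallel>p(A)\<parallel> \<le> sup |p|\<close>: if \<open>s = \<parallel>p(A)\<parallel>\<close> exceeded the supremum, then
  \<open>s\<^sup>2 - p\<^sup>2\<close> would have no root in \<open>[-\<parallel>A\<parallel>, \<parallel>A\<parallel>]\<close>, so splitting it into linear and quadratic factors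
  would show that \<open>s\<^sup>2 - p(A)\<^sup>2\<close> is bounded below, which contradicts the definition of \<open>s\<close>.

  For the error bound, a minimizer is compared with an element \<open>z\<close> of \<open>DF \<inter> DB\<close> satisfying
  \<open>\<parallel>z - xdag\<parallel> \<lesssim> \<psi>(\<alpha>)\<close>, \<open>\<parallel>z - xdag\<parallel>\<^bsub>-a\<^esub> \<lesssim> \<psi>(\<alpha>) \<alpha>\<^bsup>a/(2a+2)\<^esup>\<close> and \<open>\<parallel>B(z - xbar)\<parallel> \<lesssim> \<psi>(\<alpha>) \<alpha>\<^bsup>-1/(2a+2)\<^esup>\<close>.
  For small \<open>\<alpha>\<close> this is the minimizer of the linearized functional, which lies in \<open>DF\<close> because \<open>xdag\<close> is an
  interior point; for the remaining \<open>\<alpha>\<close> it is \<open>xbar\<close>. Interpolation between \<open>\<parallel>\<cdot>\<parallel>\<^bsub>-a\<^esub>\<close> and \<open>\<parallel>B \<cdot>\<parallel>\<close> by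
  Young's inequality, with weights chosen according to \<open>\<alpha>\<close>, loses no constant, so that the noise enters
  with the factor \<open>K\<^sub>2\<close> exactly.
\<close>

section \<open>Polynomials of a symmetric operator\<close>

lemma poly_operator_degree_le:
  assumes "degree p \<le> n"
  shows "poly_operator p A = (\<Sum>i\<le>n. coeff p i *\<^sub>R ((\<lambda>T. A o\<^sub>L T) ^^ i) id_blinfun)"
  unfolding poly_operator_def
  by (rule sum.mono_neutral_left) (use assms in \<open>auto simp: coeff_eq_0\<close>)

lemma poly_operator_0 [simp]: "poly_operator 0 A = 0"
  by (simp add: poly_operator_def)

text \<open>Horner's rule. The algebraic identities below follow from it by induction along
  \<open>pCons\<close>, so the sum over monomials need not be handled again.\<close>

lemma poly_operator_pCons:
  "poly_operator (pCons c p) A = c *\<^sub>R id_blinfun + (A o\<^sub>L poly_operator p A)"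
proof -
  let ?P = "\<lambda>i. ((\<lambda>T. A o\<^sub>L T) ^^ i) id_blinfun"
  \<comment> \<open>Only an inequality, as \<open>pCons 0 0\<close> has degree 0. The sum is
    therefore taken up to \<open>Suc (degree p)\<close>, where an excess coefficient is 0.\<close>
  have "degree (pCons c p) \<le> Suc (degree p)" by (simp add: degree_pCons_le)
  then have "poly_operator (pCons c p) A =
      (\<Sum>i\<le>Suc (degree p). coeff (pCons c p) i *\<^sub>R ?P i)"
    by (rule poly_operator_degree_le)
  also have "\<dots> = c *\<^sub>R id_blinfun + (\<Sum>i\<le>degree p. A o\<^sub>L (coeff p i *\<^sub>R ?P i))"
    by (subst sum.atMost_Suc_shift)
      (auto intro!: sum.cong blinfun_eqI simp: blinfun.bilinear_simps)
  also have "\<dots> = c *\<^sub>R id_blinfun + (A o\<^sub>L poly_operator p A)"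
    by (auto simp: poly_operator_def blinfun.bilinear_simps blinfun.sum_left blinfun.sum_right intro!: blinfun_eqI)
  finally show ?thesis .
qed

lemma poly_operator_pCons_apply:
  "poly_operator (pCons c p) A x = c *\<^sub>R x + A (poly_operator p A x)"
  by (simp add: poly_operator_pCons blinfun.bilinear_simps)

lemma poly_operator_add: "poly_operator (p + q) A = poly_operator p A + poly_operator q A"
proof (induction p arbitrary: q rule: pCons_induct)
  case (pCons c p)
  obtain d r where "q = pCons d r" by (rule pCons_cases)
  then show ?case
    by (auto simp: poly_operator_pCons_apply pCons.IH
        blinfun.bilinear_simps algebra_simps intro!: blinfun_eqI)
qed simp

lemma poly_operator_smult: "poly_operator (smult c p) A = c *\<^sub>R poly_operator p A"
  by (induction p rule: pCons_induct)
    (auto simp: poly_operator_pCons_apply blinfun.bilinear_simps algebra_simps intro!: blinfun_eqI)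

lemma poly_operator_diff: "poly_operator (p - q) A = poly_operator p A - poly_operator q A"
  using poly_operator_add[of p "smult (-1) q" A] unfolding poly_operator_smult by simp

lemma poly_operator_mult: "poly_operator (p * q) A = (poly_operator p A o\<^sub>L poly_operator q A)"
  by (induction p rule: pCons_induct)
    (auto simp: poly_operator_pCons_apply poly_operator_add poly_operator_smult
      blinfun.bilinear_simps intro!: blinfun_eqI)

section \<open>Evaluation of real polynomials in larger algebras, such as the complex
  numbers\<close>

lemma poly_map_poly_of_real:
  "poly (map_poly of_real p) (of_real t :: 'b::{real_algebra_1, comm_ring_1}) = of_real (poly p t)"
  by (induction p rule: pCons_induct) (simp_all add: map_poly_pCons)

lemma poly_map_poly_of_real_add:
  "poly (map_poly of_real (p + q)) (z :: 'b::{real_algebra_1, comm_ring_1}) =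
    poly (map_poly of_real p) z + poly (map_poly of_real q) z"
proof (induction p arbitrary: q rule: pCons_induct)
  case (pCons c p)
  obtain d r where "q = pCons d r" by (rule pCons_cases)
  then show ?case by (simp add: map_poly_pCons pCons.IH algebra_simps)
qed simp

lemma poly_map_poly_of_real_mult:
  "poly (map_poly of_real (p * q)) (z :: 'b::{real_algebra_1, comm_ring_1}) =
    poly (map_poly of_real p) z * poly (map_poly of_real q) z"
proof (induction p rule: pCons_induct)
  case (pCons c p)
  have "poly (map_poly of_real (smult c q)) z = of_real c * poly (map_poly of_real q) z"
    by (induction q rule: pCons_induct) (simp_all add: map_poly_pCons algebra_simps)
  then show ?case
    by (simp add: map_poly_pCons poly_map_poly_of_real_add pCons.IH algebra_simps)
qed simp

section \<open>Norm bound for polynomials of a bounded symmetric operator\<close>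

locale symmetric_operator =
  fixes A :: "'a::{real_inner, complete_space} \<Rightarrow>\<^sub>L 'a"
  assumes symmetric: "A x \<bullet> y = x \<bullet> A y"
begin

lemma poly_operator_commute: "poly_operator p A (A x) = A (poly_operator p A x)"
  by (induction p rule: pCons_induct) (simp_all add: poly_operator_pCons_apply blinfun.bilinear_simps)

lemma poly_operator_symmetric: "poly_operator p A x \<bullet> y = x \<bullet> poly_operator p A y"
proof (induction p arbitrary: x rule: pCons_induct)
  case (pCons c p)
  have "poly_operator (pCons c p) A x \<bullet> y = c * (x \<bullet> y) + poly_operator p A (A x) \<bullet> y"
    by (simp add: poly_operator_pCons_apply inner_simps poly_operator_commute)
  then show ?case
    unfolding pCons.IH by (simp add: poly_operator_pCons_apply inner_simps symmetric)
qed simp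

text \<open>Reverse triangle inequality: \<open>A\<close> stretches no vector by more than the
  factor \<open>norm A\<close>. This handles real roots outside
  \<open>{- norm A..norm A}\<close>.\<close>

lemma linear_factor_bounded_below:
  assumes "\<bar>r\<bar> > norm A"
  shows "norm (poly_operator [:-r, 1:] A x) \<ge> (\<bar>r\<bar> - norm A) * norm x"
proof -
  have "\<bar>r\<bar> * norm x = norm (r *\<^sub>R x)" by simp
  also have "\<dots> \<le> norm (A x - r *\<^sub>R x) + norm (A x)"
    by (metis add.commute norm_minus_commute norm_triangle_sub)
  also have "\<dots> \<le> norm (A x - r *\<^sub>R x) + norm A * norm x" by (simp add: norm_blinfun)
  finally show ?thesis by (simp add: poly_operator_pCons_apply algebra_simps)
qed

text \<open>Completing the square gives \<open>(A - b)\<^sup>2 + c\<^sup>2\<close>. By symmetry the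
  first summand has a nonnegative quadratic form, and Cauchy-Schwarz passes from the form to the
  norm. This handles a pair of conjugate roots \<open>b \<plusminus> i c\<close>.\<close>

lemma quadratic_factor_bounded_below:
  "norm (poly_operator [:b\<^sup>2 + c\<^sup>2, - 2 * b, 1:] A x) \<ge> c\<^sup>2 * norm x"
proof -
  let ?T = "poly_operator [:-b, 1:] A" and ?Q = "poly_operator [:b\<^sup>2 + c\<^sup>2, - 2 * b, 1:] A"
  have "[:b\<^sup>2 + c\<^sup>2, - 2 * b, 1:] = [:-b, 1:] * [:-b, 1:] + [:c\<^sup>2:]"
    by (simp add: power2_eq_square)
  moreover have "(2 * b) *\<^sub>R v = b *\<^sub>R v + b *\<^sub>R v" for v :: 'a
    by (metis mult_2 scaleR_add_left)
  ultimately have "?Q x = ?T (?T x) + c\<^sup>2 *\<^sub>R x"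
    by (simp add: poly_operator_mult poly_operator_pCons_apply blinfun.bilinear_simps
        scaleR_add_left scaleR_right_diff_distrib power2_eq_square)
  then have "?Q x \<bullet> x = ?T x \<bullet> ?T x + c\<^sup>2 * (norm x)\<^sup>2"
    by (simp add: inner_simps poly_operator_symmetric power2_norm_eq_inner)
  then have "c\<^sup>2 * (norm x)\<^sup>2 \<le> ?Q x \<bullet> x" by simp
  also have "\<dots> \<le> norm (?Q x) * norm x" by (rule norm_cauchy_schwarz)
  finally show ?thesis
    by (cases "x = 0") (simp_all add: power2_eq_square)
qed

text \<open>Induction on the degree, splitting off a factor for some complex root. A real root lies
  outside the interval by assumption and gives a linear factor; a nonreal one gives a real quadratic
  factor.\<close>

lemma poly_operator_bounded_below:
  assumes "\<And>t. t \<in> {- norm A..norm A} \<Longrightarrow> poly q t \<noteq> 0"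
  shows "\<exists>c>0. \<forall>x. norm (poly_operator q A x) \<ge> c * norm x"
  using assms
proof (induction "degree q" arbitrary: q rule: less_induct)
  case less
  \<comment> \<open>Lower bounds multiply under composition. The cofactor \<open>r\<close> falls
    under the induction hypothesis because each of its roots is a root of \<open>q\<close>.\<close>
  have product: ?case if "q = p * r" and "degree r < degree q" and "k > 0"
    and "\<And>x. norm (poly_operator p A x) \<ge> k * norm x" for p r k
  proof -
    have "\<exists>c>0. \<forall>x. norm (poly_operator r A x) \<ge> c * norm x"
      by (rule less.hyps) (use that less.prems in auto)
    then obtain c where c: "c > 0" "\<And>x. norm (poly_operator r A x) \<ge> c * norm x" by blast
    have "norm (poly_operator q A x) \<ge> k * c * norm x" for x
    proof -
      have "k * c * norm x \<le> k * norm (poly_operator r A x)"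
        using c \<open>k > 0\<close> by (simp add: mult.assoc)
      also have "\<dots> \<le> norm (poly_operator q A x)"
        using that by (simp add: poly_operator_mult)
      finally show ?thesis .
    qed
    then show ?thesis using c \<open>k > 0\<close> by (intro exI[of _ "k * c"]) simp
  qed
  have "q \<noteq> 0" using less.prems[of 0] by auto
  show ?case
  proof (cases "degree q = 0")
    case True
    then obtain d where "q = [:d:]" by (rule degree_eq_zeroE)
    then show ?thesis using \<open>q \<noteq> 0\<close>
      by (intro exI[of _ "\<bar>d\<bar>"]) (simp add: poly_operator_pCons_apply)
  next
    case False
    let ?qc = "map_poly complex_of_real q"
    have "\<not> constant (poly ?qc)" using False by (simp add: constant_degree degree_map_poly)
    then obtain z where z: "poly ?qc z = 0" using fundamental_theorem_of_algebra by blast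
    show ?thesis
    proof (cases "Im z = 0")
      case True
      then have "z = complex_of_real (Re z)" by (simp add: complex_eq_iff)
      then have root: "poly q (Re z) = 0"
        using z by (metis of_real_eq_0_iff poly_map_poly_of_real)
      then have "\<bar>Re z\<bar> > norm A" using less.prems[of "Re z"] by force
      obtain r where r: "q = [:- Re z, 1:] * r" using root by (auto simp: poly_eq_0_iff_dvd)
      have "degree r < degree q"
        using \<open>q \<noteq> 0\<close> unfolding r by (subst degree_mult_eq) auto
      then show ?thesis
        using product[OF r, of "\<bar>Re z\<bar> - norm A"] linear_factor_bounded_below
          \<open>\<bar>Re z\<bar> > norm A\<close> by simp
    next
      case False
      \<comment> \<open>The product of \<open>t - z\<close> and \<open>t - cnj z\<close>.\<close>
      define s where "s = [:(Re z)\<^sup>2 + (Im z)\<^sup>2, - 2 * Re z, 1:]"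
      have s: "poly (map_poly complex_of_real s) z = 0"
        by (simp add: s_def complex_eq_iff map_poly_pCons power2_eq_square algebra_simps)
      have "degree s = 2" by (simp add: s_def)
      then have "degree (q mod s) < 2"
        by (metis degree_0 degree_mod_less' zero_less_numeral zero_neq_numeral)
      then obtain u v where uv: "q mod s = [:u, v:]"
        by (metis (no_types, opaque_lifting) One_nat_def Suc_1 degree_eq_zeroE degree_pCons_eq
            less_2_cases_iff less_Suc_eq_le le_zero_eq pCons_cases nat.inject pCons_0_0)
      have "poly ?qc z = poly (map_poly of_real (q div s * s + q mod s)) z" by simp
      then have "poly (map_poly complex_of_real (q mod s)) z = 0"
        using z s unfolding poly_map_poly_of_real_add poly_map_poly_of_real_mult by simp
      \<comment> \<open>The remainder \<open>u + v t\<close> is real and vanishes at a nonreal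
        point: the imaginary part forces \<open>v = 0\<close>, then the real part forces
        \<open>u = 0\<close>, so \<open>s\<close> divides \<open>q\<close>.\<close>
      then have "complex_of_real u + z * of_real v = 0"
        by (simp add: uv map_poly_pCons)
      then have "v = 0" "u = 0" using False by (auto simp: complex_eq_iff)
      then have r: "q = s * (q div s)" using uv by (metis div_mult_mod_eq add.right_neutral mult.commute pCons_0_0)
      have "degree (q div s) < degree q"
      proof -
        have "s \<noteq> 0" "q div s \<noteq> 0" using r \<open>q \<noteq> 0\<close> by auto
        then have "degree q = 2 + degree (q div s)"
          using \<open>degree s = 2\<close> degree_mult_eq r by metis
        then show ?thesis by simp
      qed
      then show ?thesis
        using product[OF r, of "(Im z)\<^sup>2"] quadratic_factor_bounded_below False
        unfolding s_def by simp
    qed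
  qed
qed

lemma norm_poly_operator_le:
  assumes "\<And>t. t \<in> {- norm A..norm A} \<Longrightarrow> \<bar>poly p t\<bar> \<le> b"
  shows "norm (poly_operator p A) \<le> b"
proof (rule ccontr)
  define T where "T = poly_operator p A"
  define s where "s = norm T"
  assume "\<not> norm (poly_operator p A) \<le> b"
  then have "b < s" by (simp add: s_def T_def)
  have "0 \<le> b" using assms[of 0] by simp
  then have "0 < s" using \<open>b < s\<close> by simp
  let ?q = "[:s\<^sup>2:] - p * p"
  have "poly ?q t \<noteq> 0" if "t \<in> {- norm A..norm A}" for t
  proof -
    have "(poly p t)\<^sup>2 \<le> b\<^sup>2" using assms[OF that] by (simp add: abs_le_square_iff[symmetric])
    also have "b\<^sup>2 < s\<^sup>2" using \<open>b < s\<close> \<open>0 \<le> b\<close> by (simp add: power_strict_mono)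
    finally show ?thesis by (simp add: power2_eq_square)
  qed
  then obtain c where "c > 0" and c: "\<And>x. norm (poly_operator ?q A x) \<ge> c * norm x"
    using poly_operator_bounded_below by blast
  have q: "poly_operator ?q A x = s\<^sup>2 *\<^sub>R x - T (T x)" for x
    by (simp add: T_def poly_operator_diff poly_operator_mult poly_operator_pCons_apply
        blinfun.bilinear_simps)
  \<comment> \<open>Squaring the lower bound for \<open>s\<^sup>2 - T\<^sup>2\<close> and estimating
    \<open>norm (T (T x))\<close> by \<open>s * norm (T x)\<close> improves the factor
    \<open>s\<^sup>2\<close> by the fixed amount \<open>c\<^sup>2 / s\<^sup>2\<close>, so the norm
    of \<open>T\<close> would be smaller than \<open>s\<close>.\<close>
  have Tx: "(norm (T x))\<^sup>2 \<le> (s\<^sup>2 - c\<^sup>2 / s\<^sup>2) * (norm x)\<^sup>2" for x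
  proof -
    have "(c * norm x)\<^sup>2 \<le> (norm (s\<^sup>2 *\<^sub>R x - T (T x)))\<^sup>2"
      using c[of x] \<open>c > 0\<close> unfolding q by (intro power_mono) auto
    also have "\<dots> = (s\<^sup>2)\<^sup>2 * (norm x)\<^sup>2 - 2 * s\<^sup>2 * (x \<bullet> T (T x)) + (norm (T (T x)))\<^sup>2"
      unfolding power2_norm_eq_inner
      by (simp add: inner_simps inner_commute[of "T (T x)" x])
        (simp add: power4_eq_xxxx power2_eq_square algebra_simps)
    also have "x \<bullet> T (T x) = (norm (T x))\<^sup>2"
      by (simp add: T_def power2_norm_eq_inner poly_operator_symmetric)
    also have "(norm (T (T x)))\<^sup>2 \<le> (s * norm (T x))\<^sup>2"
      by (intro power_mono) (simp_all add: s_def norm_blinfun)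
    finally have "s\<^sup>2 * (norm (T x))\<^sup>2 \<le> (s\<^sup>2)\<^sup>2 * (norm x)\<^sup>2 - c\<^sup>2 * (norm x)\<^sup>2"
      by (simp add: power_mult_distrib)
    also have "\<dots> = s\<^sup>2 * ((s\<^sup>2 - c\<^sup>2 / s\<^sup>2) * (norm x)\<^sup>2)"
      using \<open>0 < s\<close> by (simp add: field_simps power2_eq_square)
    finally show ?thesis using \<open>0 < s\<close> by simp
  qed
  \<comment> \<open>The maximum makes the candidate bound nonnegative without a discussion of signs;
    it remains below \<open>s\<close> since \<open>s > 0\<close>.\<close>
  let ?r = "sqrt (max 0 (s\<^sup>2 - c\<^sup>2 / s\<^sup>2))"
  have "norm T \<le> ?r"
  proof (rule norm_blinfun_bound)
    fix x
    have "norm (T x) \<le> sqrt ((s\<^sup>2 - c\<^sup>2 / s\<^sup>2) * (norm x)\<^sup>2)"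
      using Tx by (intro real_le_rsqrt)
    also have "\<dots> \<le> ?r * norm x"
      by (simp add: real_sqrt_mult mult_right_mono)
    finally show "norm (T x) \<le> ?r * norm x" .
  qed simp
  also have "?r < sqrt (s\<^sup>2)"
    using \<open>c > 0\<close> \<open>0 < s\<close> by (intro real_sqrt_less_mono) simp
  finally show False using \<open>0 < s\<close> by (simp add: s_def)
qed

end

section \<open>Completeness of operator spaces and Weierstrass approximation\<close>

text \<open>The limit is formed pointwise in the complete codomain. It is bounded because a Cauchy
  sequence is, and it is a limit in operator norm because the Cauchy estimate survives letting the
  second index tend to infinity.\<close>

lemma Cauchy_blinfun_convergent:
  fixes T :: "nat \<Rightarrow> 'a::real_normed_vector \<Rightarrow>\<^sub>L 'b::{real_normed_vector, complete_space}"
  assumes "Cauchy T"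
  shows "convergent T"
proof -
  have bound: "norm (T m x - T n x) \<le> norm (T m - T n) * norm x" for m n x
    using norm_blinfun[of "T m - T n" x] by (simp add: blinfun.bilinear_simps)
  have "Cauchy (\<lambda>n. T n x)" for x
  proof (rule metric_CauchyI)
    fix e :: real assume "e > 0"
    then obtain N where N: "\<And>m n. m \<ge> N \<Longrightarrow> n \<ge> N \<Longrightarrow> norm (T m - T n) < e / (norm x + 1)"
      using CauchyD[OF assms, of "e / (norm x + 1)"] by (auto simp: add_nonneg_pos)
    have "dist (T m x) (T n x) < e" if "m \<ge> N" "n \<ge> N" for m n
    proof -
      have "dist (T m x) (T n x) \<le> norm (T m - T n) * (norm x + 1)"
        using bound[of m x n] by (simp add: dist_norm distrib_left add_increasing2)
      also have "\<dots> < e" using N[OF that] by (simp add: pos_less_divide_eq add_nonneg_pos)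
      finally show ?thesis .
    qed
    then show "\<exists>M. \<forall>m\<ge>M. \<forall>n\<ge>M. dist (T m x) (T n x) < e" by blast
  qed
  then have "\<exists>l. (\<lambda>n. T n x) \<longlonglongrightarrow> l" for x
    by (simp add: Cauchy_convergent_iff flip: convergent_def)
  then obtain L where L: "\<And>x. (\<lambda>n. T n x) \<longlonglongrightarrow> L x" by metis
  obtain K where K: "\<And>n. norm (T n) \<le> K"
    using Cauchy_Bseq[OF assms] by (auto simp: Bseq_def)
  have "bounded_linear L"
  proof (rule bounded_linear_intro)
    show "L (x + y) = L x + L y" for x y
      using tendsto_add[OF L L, of x y] L[of "x + y"]
      by (auto simp: blinfun.bilinear_simps intro: LIMSEQ_unique)
    show "L (r *\<^sub>R x) = r *\<^sub>R L x" for r x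
      using tendsto_scaleR[OF tendsto_const L, of r x] L[of "r *\<^sub>R x"]
      by (auto simp: blinfun.bilinear_simps intro: LIMSEQ_unique)
    show "norm (L x) \<le> norm x * K" for x
    proof (rule tendsto_upperbound[OF tendsto_norm[OF L]])
      show "\<forall>\<^sub>F n in sequentially. norm (T n x) \<le> norm x * K"
        by (intro always_eventually allI order.trans[OF norm_blinfun])
          (simp add: K mult.commute[of _ "norm x"] mult_left_mono)
    qed simp
  qed
  then have Blinfun_L: "Blinfun L x = L x" for x by (simp add: bounded_linear_Blinfun_apply)
  have "T \<longlonglongrightarrow> Blinfun L"
  proof (rule LIMSEQ_I)
    fix e :: real assume "e > 0"
    then obtain N where N: "\<And>m n. m \<ge> N \<Longrightarrow> n \<ge> N \<Longrightarrow> norm (T m - T n) < e / 2"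
      using CauchyD[OF assms, of "e / 2"] by auto
    have "norm (T n - Blinfun L) < e" if "n \<ge> N" for n
    proof -
      have "norm (T n - Blinfun L) \<le> e / 2"
      proof (rule norm_blinfun_bound)
        fix x
        have "norm (T n x - L x) \<le> e / 2 * norm x"
        proof (rule tendsto_upperbound[OF tendsto_norm[OF tendsto_diff[OF tendsto_const L]]])
          show "\<forall>\<^sub>F k in sequentially. norm (T n x - T k x) \<le> e / 2 * norm x"
            using eventually_ge_at_top[of N]
          proof eventually_elim
            case (elim k)
            show ?case
              using N[OF that elim] by (intro order.trans[OF bound] mult_right_mono) auto
          qed
        qed simp
        then show "norm ((T n - Blinfun L) x) \<le> e / 2 * norm x"
          by (simp add: blinfun.bilinear_simps Blinfun_L)
      qed (use \<open>e > 0\<close> in simp)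
      then show ?thesis using \<open>e > 0\<close> by simp
    qed
    then show "\<exists>no. \<forall>n\<ge>no. norm (T n - Blinfun L) < e" by blast
  qed
  then show ?thesis by (rule convergentI)
qed

text \<open>Stone-Weierstrass with tolerance \<open>1 / Suc n\<close>, the polynomial functions
  being rewritten as values of \<open>poly\<close> so that \<open>poly_operator\<close>
  applies.\<close>

lemma poly_uniform_approximation:
  fixes f :: "real \<Rightarrow> real"
  assumes "compact S" "continuous_on S f"
  obtains p where "uniform_limit S (\<lambda>n. poly (p n)) f sequentially"
proof -
  have "\<exists>p. \<forall>x\<in>S. \<bar>f x - poly p x\<bar> < 1 / real (Suc n)" for n
  proof -
    obtain g where g: "real_polynomial_function g" "\<And>x. x \<in> S \<Longrightarrow> \<bar>f x - g x\<bar> < 1 / real (Suc n)"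
      using Stone_Weierstrass_real_polynomial_function[OF assms, of "1 / real (Suc n)"]
      by (metis of_nat_0_less_iff zero_less_Suc zero_less_divide_1_iff)
    then obtain a k where "g = (\<lambda>x. \<Sum>i\<le>k. a i * x ^ i)"
      unfolding real_polynomial_function_iff_sum by blast
    then have "g = poly (\<Sum>i\<le>k. monom (a i) i)" by (intro ext) (simp add: poly_sum poly_monom)
    then show ?thesis using g by blast
  qed
  then obtain p where p: "\<And>n x. x \<in> S \<Longrightarrow> \<bar>f x - poly (p n) x\<bar> < 1 / real (Suc n)" by metis
  have "uniform_limit S (\<lambda>n. poly (p n)) f sequentially"
  proof (rule uniform_limitI)
    fix e :: real assume "e > 0"
    have "\<forall>\<^sub>F n in sequentially. 1 / real (Suc n) < e"
      using \<open>e > 0\<close> LIMSEQ_inverse_real_of_nat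
      by (intro order_tendstoD(2)) (simp_all add: inverse_eq_divide)
    then show "\<forall>\<^sub>F n in sequentially. \<forall>x\<in>S. dist (poly (p n) x) (f x) < e"
    proof eventually_elim
      case (elim n)
      then show ?case using p by (force simp: dist_real_def abs_minus_commute intro: less_trans)
    qed
  qed
  then show ?thesis using that by blast
qed

section \<open>Continuous functional calculus\<close>

context symmetric_operator
begin

text \<open>This interval stands in for the spectrum: continuity, bounds and equalities of functions
  are always required on all of it.\<close>

abbreviation "I \<equiv> {- norm A..norm A}"

text \<open>Two sequences and two indices make the estimate serve twice: \<open>q = p\<close> gives
  the Cauchy property, and \<open>m = n\<close> shows that the limit does not depend on the
  approximating sequence.\<close>

lemma poly_operator_uniform_diff:
  assumes "uniform_limit I (\<lambda>n. poly (p n)) f sequentially"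
    and "uniform_limit I (\<lambda>n. poly (q n)) f sequentially" and "e > 0"
  shows "\<exists>N. \<forall>m\<ge>N. \<forall>n\<ge>N. norm (poly_operator (p m) A - poly_operator (q n) A) < e"
proof -
  have "\<forall>\<^sub>F n in sequentially. (\<forall>t\<in>I. dist (poly (p n) t) (f t) < e / 3)
      \<and> (\<forall>t\<in>I. dist (poly (q n) t) (f t) < e / 3)"
    using assms by (intro eventually_conj uniform_limitD) auto
  then obtain N where N: "\<And>n t. n \<ge> N \<Longrightarrow> t \<in> I \<Longrightarrow>
      dist (poly (p n) t) (f t) < e / 3 \<and> dist (poly (q n) t) (f t) < e / 3"
    unfolding eventually_sequentially by blast
  have "norm (poly_operator (p m) A - poly_operator (q n) A) < e" if "m \<ge> N" "n \<ge> N" for m n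
  proof -
    have "norm (poly_operator (p m - q n) A) \<le> 2 * e / 3"
    proof (rule norm_poly_operator_le)
      fix t assume t: "t \<in> I"
      show "\<bar>poly (p m - q n) t\<bar> \<le> 2 * e / 3"
        using N[OF \<open>m \<ge> N\<close> t] N[OF \<open>n \<ge> N\<close> t]
        unfolding dist_real_def poly_diff by linarith
    qed
    then show ?thesis using \<open>e > 0\<close> by (simp add: poly_operator_diff)
  qed
  then show ?thesis by blast
qed

text \<open>Here the definite description in \<open>spectral_calculus\<close> is shown to denote:
  existence comes from completeness, uniqueness from comparing two approximating sequences.\<close>

lemma poly_operator_tendsto_spectral_calculus:
  assumes p: "uniform_limit I (\<lambda>n. poly (p n)) f sequentially"
  shows "(\<lambda>n. poly_operator (p n) A) \<longlonglongrightarrow> spectral_calculus f A"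
proof -
  have "convergent (\<lambda>n. poly_operator (p n) A)"
    by (intro Cauchy_blinfun_convergent CauchyI poly_operator_uniform_diff[OF p p])
  then obtain T where T: "(\<lambda>n. poly_operator (p n) A) \<longlonglongrightarrow> T" by (auto simp: convergent_def)
  have unique: "T' = T" if "uniform_limit I (\<lambda>n. poly (q n)) f sequentially"
    and T': "(\<lambda>n. poly_operator (q n) A) \<longlonglongrightarrow> T'" for q T'
  proof -
    have "(\<lambda>n. poly_operator (q n) A - poly_operator (p n) A) \<longlonglongrightarrow> 0"
      by (rule LIMSEQ_I) (use poly_operator_uniform_diff[OF that(1) p] in fastforce)
    then have "T' - T = 0" using tendsto_diff[OF T' T] by (rule LIMSEQ_unique[rotated])
    then show ?thesis by simp
  qed
  have "spectral_calculus f A = T"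
    unfolding spectral_calculus_def using p T unique by (intro the_equality) blast+
  then show ?thesis using T by simp
qed

lemma spectral_calculus_approximation:
  assumes "continuous_on I f"
  obtains p where "uniform_limit I (\<lambda>n. poly (p n)) f sequentially"
    "(\<lambda>n. poly_operator (p n) A) \<longlonglongrightarrow> spectral_calculus f A"
  using poly_uniform_approximation[OF _ assms] poly_operator_tendsto_spectral_calculus by blast

lemma spectral_calculus_eqI:
  assumes "uniform_limit I (\<lambda>n. poly (p n)) f sequentially"
    and "(\<lambda>n. poly_operator (p n) A) \<longlonglongrightarrow> T"
  shows "spectral_calculus f A = T"
  using LIMSEQ_unique poly_operator_tendsto_spectral_calculus[OF assms(1)] assms(2) by blast

lemma spectral_calculus_cong:
  assumes "continuous_on I f" "\<And>t. t \<in> I \<Longrightarrow> f t = g t"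
  shows "spectral_calculus f A = spectral_calculus g A"
proof -
  obtain p where p: "uniform_limit I (\<lambda>n. poly (p n)) f sequentially"
    "(\<lambda>n. poly_operator (p n) A) \<longlonglongrightarrow> spectral_calculus f A"
    using spectral_calculus_approximation[OF assms(1)] .
  have "uniform_limit I (\<lambda>n. poly (p n)) g sequentially"
    using p(1) assms(2) by (subst uniform_limit_cong'[of _ _ "\<lambda>n. poly (p n)" _ f]) auto
  then show ?thesis using p(2) spectral_calculus_eqI by metis
qed

lemma spectral_calculus_poly: "spectral_calculus (poly p) A = poly_operator p A"
  by (rule spectral_calculus_eqI[of "\<lambda>_. p"]) (simp_all add: uniform_limit_const)

lemma spectral_calculus_const: "spectral_calculus (\<lambda>_. c) A = c *\<^sub>R id_blinfun"
proof -
  have "poly [:c:] = (\<lambda>_. c)" by (simp add: fun_eq_iff)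
  then show ?thesis using spectral_calculus_poly[of "[:c:]"] by (simp add: poly_operator_pCons)
qed

lemma spectral_calculus_ident: "spectral_calculus (\<lambda>t. t) A = A"
proof -
  have "poly [:0, 1:] = (\<lambda>t::real. t)" by (simp add: fun_eq_iff)
  moreover have "poly_operator [:0, 1:] A = A"
    by (simp add: poly_operator_pCons_apply blinfun_eqI)
  ultimately show ?thesis using spectral_calculus_poly[of "[:0, 1:]"] by simp
qed

lemma spectral_calculus_add:
  assumes "continuous_on I f" "continuous_on I g"
  shows "spectral_calculus (\<lambda>t. f t + g t) A = spectral_calculus f A + spectral_calculus g A"
proof -
  obtain p where p: "uniform_limit I (\<lambda>n. poly (p n)) f sequentially"
    "(\<lambda>n. poly_operator (p n) A) \<longlonglongrightarrow> spectral_calculus f A"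
    using spectral_calculus_approximation[OF assms(1)] .
  obtain q where q: "uniform_limit I (\<lambda>n. poly (q n)) g sequentially"
    "(\<lambda>n. poly_operator (q n) A) \<longlonglongrightarrow> spectral_calculus g A"
    using spectral_calculus_approximation[OF assms(2)] .
  have "poly (p n + q n) = (\<lambda>t. poly (p n) t + poly (q n) t)" for n by (simp add: fun_eq_iff)
  then show ?thesis
    using uniform_limit_add[OF p(1) q(1)] tendsto_add[OF p(2) q(2)]
    by (intro spectral_calculus_eqI[of "\<lambda>n. p n + q n"]) (simp_all add: poly_operator_add)
qed

lemma spectral_calculus_mult:
  assumes "continuous_on I f" "continuous_on I g"
  shows "spectral_calculus (\<lambda>t. f t * g t) A = (spectral_calculus f A o\<^sub>L spectral_calculus g A)"
proof -
  obtain p where p: "uniform_limit I (\<lambda>n. poly (p n)) f sequentially"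
    "(\<lambda>n. poly_operator (p n) A) \<longlonglongrightarrow> spectral_calculus f A"
    using spectral_calculus_approximation[OF assms(1)] .
  obtain q where q: "uniform_limit I (\<lambda>n. poly (q n)) g sequentially"
    "(\<lambda>n. poly_operator (q n) A) \<longlonglongrightarrow> spectral_calculus g A"
    using spectral_calculus_approximation[OF assms(2)] .
  \<comment> \<open>Products of uniform limits need bounded limit functions, which compactness of
    the interval supplies.\<close>
  have "uniform_limit I (\<lambda>n t. poly (p n) t * poly (q n) t) (\<lambda>t. f t * g t) sequentially"
    using p(1) q(1) assms
    by (intro uniform_lim_mult compact_imp_bounded compact_continuous_image) auto
  moreover have "(\<lambda>n. poly_operator (p n) A o\<^sub>L poly_operator (q n) A) \<longlonglongrightarrow>
      (spectral_calculus f A o\<^sub>L spectral_calculus g A)"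
    by (rule bounded_bilinear.tendsto[OF bounded_bilinear_blinfun_compose p(2) q(2)])
  moreover have "poly (p n * q n) = (\<lambda>t. poly (p n) t * poly (q n) t)" for n
    by (simp add: fun_eq_iff)
  ultimately show ?thesis
    by (intro spectral_calculus_eqI[of "\<lambda>n. p n * q n"]) (simp_all add: poly_operator_mult)
qed

lemma spectral_calculus_scale:
  assumes "continuous_on I f"
  shows "spectral_calculus (\<lambda>t. c * f t) A = c *\<^sub>R spectral_calculus f A"
  by (subst spectral_calculus_mult)
    (use assms in \<open>auto simp: spectral_calculus_const blinfun.bilinear_simps intro: blinfun_eqI\<close>)

lemma spectral_calculus_symmetric:
  assumes "continuous_on I f"
  shows "spectral_calculus f A x \<bullet> y = x \<bullet> spectral_calculus f A y"
proof -
  obtain p where p: "(\<lambda>n. poly_operator (p n) A) \<longlonglongrightarrow> spectral_calculus f A"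
    using spectral_calculus_approximation[OF assms] .
  have lim: "(\<lambda>n. poly_operator (p n) A v) \<longlonglongrightarrow> spectral_calculus f A v" for v
    by (intro blinfun.tendsto p tendsto_const)
  show ?thesis
    using tendsto_inner[OF lim[of x] tendsto_const[of y]]
      tendsto_inner[OF tendsto_const[of x] lim[of y]]
    by (auto simp: poly_operator_symmetric intro: LIMSEQ_unique)
qed

lemma norm_spectral_calculus_le:
  assumes "continuous_on I f" "\<And>t. t \<in> I \<Longrightarrow> \<bar>f t\<bar> \<le> b"
  shows "norm (spectral_calculus f A) \<le> b"
\<comment> \<open>The approximating polynomials satisfy the bound only up to an error
  \<open>e\<close>.\<close>
proof (rule field_le_epsilon)
  fix e :: real assume "e > 0"
  obtain p where p: "uniform_limit I (\<lambda>n. poly (p n)) f sequentially"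
    "(\<lambda>n. poly_operator (p n) A) \<longlonglongrightarrow> spectral_calculus f A"
    using spectral_calculus_approximation[OF assms(1)] .
  show "norm (spectral_calculus f A) \<le> b + e"
  proof (rule tendsto_upperbound[OF tendsto_norm[OF p(2)]])
    show "\<forall>\<^sub>F n in sequentially. norm (poly_operator (p n) A) \<le> b + e"
      using uniform_limitD[OF p(1) \<open>e > 0\<close>]
    proof eventually_elim
      case (elim n)
      show ?case
      proof (rule norm_poly_operator_le)
        fix t assume "t \<in> I"
        then show "\<bar>poly (p n) t\<bar> \<le> b + e"
          using elim assms(2) by (force simp: dist_real_def)
      qed
    qed
  qed simp
qed

lemma norm_spectral_calculus_apply_le:
  assumes "continuous_on I f" "\<And>t. t \<in> I \<Longrightarrow> \<bar>f t\<bar> \<le> b"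
  shows "norm (spectral_calculus f A x) \<le> b * norm x"
  using norm_spectral_calculus_le[OF assms]
  by (intro order.trans[OF norm_blinfun] mult_right_mono) auto

lemma power2_norm_spectral_calculus:
  assumes "continuous_on I f"
  shows "(norm (spectral_calculus f A x))\<^sup>2 = spectral_calculus (\<lambda>t. (f t)\<^sup>2) A x \<bullet> x"
proof -
  have "spectral_calculus (\<lambda>t. (f t)\<^sup>2) A = (spectral_calculus f A o\<^sub>L spectral_calculus f A)"
    unfolding power2_eq_square by (rule spectral_calculus_mult[OF assms assms])
  then show ?thesis by (simp add: power2_norm_eq_inner spectral_calculus_symmetric[OF assms])
qed

text \<open>The difference \<open>g - f\<close> is the square of the continuous function
  \<open>sqrt (g - f)\<close>, so the two forms differ by a squared norm.\<close>

lemma spectral_calculus_form_mono: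
  assumes "continuous_on I f" "continuous_on I g" "\<And>t. t \<in> I \<Longrightarrow> f t \<le> g t"
  shows "spectral_calculus f A x \<bullet> x \<le> spectral_calculus g A x \<bullet> x"
proof -
  let ?h = "\<lambda>t. sqrt (g t - f t)"
  have h: "continuous_on I ?h" using assms by (intro continuous_intros) auto
  have "spectral_calculus g A = spectral_calculus (\<lambda>t. f t + (?h t)\<^sup>2) A"
    by (rule spectral_calculus_cong) (use assms in auto)
  also have "\<dots> = spectral_calculus f A + spectral_calculus (\<lambda>t. (?h t)\<^sup>2) A"
    by (rule spectral_calculus_add) (use assms h in \<open>auto intro!: continuous_intros\<close>)
  finally have "spectral_calculus g A x \<bullet> x = 
      spectral_calculus f A x \<bullet> x + (norm (spectral_calculus ?h A x))\<^sup>2"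
    by (simp add: power2_norm_spectral_calculus[OF h] blinfun.bilinear_simps inner_simps)
  then show ?thesis by simp
qed

end

section \<open>Norms of powers and composition of functions in the calculus\<close>

text \<open>By symmetry the square of \<open>norm (T x)\<close> is the form of
  \<open>T o\<^sub>L T\<close> at \<open>x\<close>, to which Cauchy-Schwarz applies.\<close>

lemma symmetric_norm_square_le:
  fixes T :: "'a::real_inner \<Rightarrow>\<^sub>L 'a"
  assumes "\<And>x y. T x \<bullet> y = x \<bullet> T y"
  shows "(norm T)\<^sup>2 \<le> norm (T o\<^sub>L T)"
proof -
  have "norm T \<le> sqrt (norm (T o\<^sub>L T))"
  proof (rule norm_blinfun_bound)
    fix x
    have "(norm (T x))\<^sup>2 = (T o\<^sub>L T) x \<bullet> x" by (simp add: power2_norm_eq_inner assms)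
    also have "\<dots> \<le> norm (T o\<^sub>L T) * norm x * norm x"
      by (intro order.trans[OF norm_cauchy_schwarz] mult_right_mono norm_blinfun) simp
    finally have "norm (T x) \<le> sqrt (norm (T o\<^sub>L T) * (norm x)\<^sup>2)"
      by (intro real_le_rsqrt) (simp add: power2_eq_square)
    then show "norm (T x) \<le> sqrt (norm (T o\<^sub>L T)) * norm x" by (simp add: real_sqrt_mult)
  qed simp
  then show ?thesis by (metis norm_ge_zero real_sqrt_le_iff real_sqrt_power real_sqrt_unique)
qed

lemma continuous_on_abs_powr [continuous_intros]:
  fixes f :: "'a::topological_space \<Rightarrow> real"
  assumes "continuous_on S f" "s > 0"
  shows "continuous_on S (\<lambda>t. \<bar>f t\<bar> powr s)"
  using assms by (intro continuous_on_powr' continuous_intros) auto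

context symmetric_operator
begin

lemma spectral_calculus_diff:
  assumes "continuous_on I f" "continuous_on I g"
  shows "spectral_calculus (\<lambda>t. f t - g t) A = spectral_calculus f A - spectral_calculus g A"
proof -
  have "continuous_on I (\<lambda>t. f t - g t)" using assms by (intro continuous_intros)
  from spectral_calculus_add[OF this assms(2)] show ?thesis by simp
qed

lemma spectral_calculus_uniform_limit:
  assumes "\<And>n. continuous_on I (h n)" "continuous_on I f" "uniform_limit I h f sequentially"
  shows "(\<lambda>n. spectral_calculus (h n) A) \<longlonglongrightarrow> spectral_calculus f A"
proof (rule tendstoI)
  fix e :: real assume "e > 0"
  then have "\<forall>\<^sub>F n in sequentially. \<forall>t\<in>I. dist (h n t) (f t) < e / 2"
    using uniform_limitD[OF assms(3), of "e / 2"] by simp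
  then show "\<forall>\<^sub>F n in sequentially. dist (spectral_calculus (h n) A) (spectral_calculus f A) < e"
  proof eventually_elim
    case n: (elim n)
    have "norm (spectral_calculus (\<lambda>t. h n t - f t) A) \<le> e / 2"
      using n assms by (intro norm_spectral_calculus_le continuous_intros)
        (auto simp: dist_real_def intro: less_imp_le)
    then show "dist (spectral_calculus (h n) A) (spectral_calculus f A) < e"
      using \<open>e > 0\<close> by (simp add: dist_norm spectral_calculus_diff assms)
  qed
qed

text \<open>Repeated squaring: \<open>symmetric_norm_square_le\<close> doubles the exponent in each
  step.\<close>

lemma norm_power_le: "norm A ^ 2 ^ n \<le> norm (spectral_calculus (\<lambda>t. t ^ 2 ^ n) A)"
proof (induction n)
  case 0
  then show ?case by (simp add: spectral_calculus_ident)
next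
  case (Suc n)
  let ?T = "spectral_calculus (\<lambda>t. t ^ 2 ^ n) A"
  have cont: "continuous_on I (\<lambda>t. t ^ 2 ^ n)" by (intro continuous_intros)
  have "norm A ^ 2 ^ Suc n = (norm A ^ 2 ^ n)\<^sup>2"
    by (simp add: mult.commute flip: power_mult)
  also have "\<dots> \<le> (norm ?T)\<^sup>2" by (intro power_mono Suc.IH) simp
  also have "\<dots> \<le> norm (?T o\<^sub>L ?T)"
    by (intro symmetric_norm_square_le spectral_calculus_symmetric cont)
  also have "(?T o\<^sub>L ?T) = spectral_calculus (\<lambda>t. t ^ 2 ^ Suc n) A"
    by (simp add: mult_2 power_add flip: spectral_calculus_mult[OF cont cont])
  finally show ?case .
qed

text \<open>A large integer power of \<open>A\<close> factors as \<open>|A|\<close> to the power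
  \<open>s\<close> times a remaining power, whose norm is bounded by the same power of
  \<open>norm A\<close> and can be cancelled. The result provides the range condition in
  \<open>spectral_calculus_compose\<close> for \<open>g t = \<bar>t\<bar> powr s\<close>.\<close>

lemma norm_powr_le:
  assumes "s > 0"
  shows "norm A powr s \<le> norm (spectral_calculus (\<lambda>t. \<bar>t\<bar> powr s) A)"
proof (cases "norm A = 0")
  case False
  then have "norm A > 0" by simp
  let ?G = "spectral_calculus (\<lambda>t. \<bar>t\<bar> powr s) A"
  obtain n where "s < 2 ^ n" using real_arch_pow[of 2 s] by auto
  \<comment> \<open>The successor makes \<open>N\<close> even, so that \<open>t ^ N\<close> agrees
    with \<open>\<bar>t\<bar> ^ N\<close> also for negative \<open>t\<close>.\<close>
  define N where "N = (2::nat) ^ Suc n"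
  have sN: "s < real N" using \<open>s < 2 ^ n\<close> \<open>s > 0\<close> by (simp add: N_def)
  have abs: "t ^ N = \<bar>t\<bar> powr s * \<bar>t\<bar> powr (real N - s)" for t :: real
  proof (cases "t = 0")
    case True
    then show ?thesis by (simp add: N_def)
  next
    case False
    have "\<bar>t\<bar> powr s * \<bar>t\<bar> powr (real N - s) = \<bar>t\<bar> ^ N"
      using False by (simp add: powr_realpow flip: powr_add)
    also have "\<dots> = t ^ N" by (simp add: N_def power_even_abs)
    finally show ?thesis by simp
  qed
  have "norm A powr s * norm A powr (real N - s) = norm A ^ N" using abs[of "norm A"] by simp
  also have "\<dots> \<le> norm (spectral_calculus (\<lambda>t. t ^ N) A)" unfolding N_def by (rule norm_power_le)
  also have "spectral_calculus (\<lambda>t. t ^ N) A =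
      (?G o\<^sub>L spectral_calculus (\<lambda>t. \<bar>t\<bar> powr (real N - s)) A)"
    unfolding abs using sN \<open>s > 0\<close> by (intro spectral_calculus_mult continuous_intros) auto
  also have "norm \<dots> \<le> norm ?G * norm (spectral_calculus (\<lambda>t. \<bar>t\<bar> powr (real N - s)) A)"
    by (rule norm_blinfun_compose)
  also have "\<dots> \<le> norm ?G * norm A powr (real N - s)"
    using sN by (intro mult_left_mono norm_spectral_calculus_le continuous_intros)
      (auto intro!: powr_mono2)
  finally show ?thesis using \<open>norm A > 0\<close> by simp
qed simp

text \<open>
  The bound on \<open>g\<close> makes \<open>f\<close> continuous where it is composed with \<open>g\<close>: the calculus of \<open>g(A)\<close> lives
  on the interval of radius \<open>\<parallel>g(A)\<parallel>\<close>, which could be smaller than the range of \<open>g\<close>.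
\<close>
lemma spectral_calculus_compose:
  fixes g :: "real \<Rightarrow> real"
  defines "G \<equiv> spectral_calculus g A"
  assumes g: "continuous_on I g" "\<And>t. t \<in> I \<Longrightarrow> \<bar>g t\<bar> \<le> norm G"
    and f: "continuous_on {- norm G..norm G} f"
  shows "spectral_calculus f G = spectral_calculus (\<lambda>t. f (g t)) A"
proof -
  interpret G: symmetric_operator G
    by unfold_locales (simp add: G_def spectral_calculus_symmetric g)
  have range: "g ` I \<subseteq> {- norm G..norm G}" using g(2) by (fastforce simp: abs_le_iff)
  have cont: "continuous_on I (\<lambda>t. poly q (g t))" for q
    using g(1) by (intro continuous_intros)
  \<comment> \<open>For polynomials the composition rule is algebra, by Horner's rule; the general
    case follows by uniform approximation on the range of \<open>g\<close>.\<close>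
  have poly: "poly_operator q G = spectral_calculus (\<lambda>t. poly q (g t)) A" for q
  proof (induction q rule: pCons_induct)
    case 0
    then show ?case using spectral_calculus_const[of 0] by simp
  next
    case (pCons c q)
    have "spectral_calculus (\<lambda>t. c + g t * poly q (g t)) A = 
        c *\<^sub>R id_blinfun + (G o\<^sub>L spectral_calculus (\<lambda>t. poly q (g t)) A)"
      using g(1) cont by (simp add: spectral_calculus_add spectral_calculus_mult
          spectral_calculus_const G_def continuous_intros)
    then show ?case by (simp add: poly_operator_pCons pCons.IH)
  qed
  obtain q where q: "uniform_limit {- norm G..norm G} (\<lambda>n. poly (q n)) f sequentially"
    "(\<lambda>n. poly_operator (q n) G) \<longlonglongrightarrow> spectral_calculus f G"
    using G.spectral_calculus_approximation[OF f] .
  have "uniform_limit I (\<lambda>n t. poly (q n) (g t)) (\<lambda>t. f (g t)) sequentially"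
    using uniform_limit_compose'[OF q(1), of g I] range by auto
  then have "(\<lambda>n. spectral_calculus (\<lambda>t. poly (q n) (g t)) A) \<longlonglongrightarrow>
      spectral_calculus (\<lambda>t. f (g t)) A"
    using cont range g(1) f by (intro spectral_calculus_uniform_limit)
      (auto intro: continuous_on_compose2[OF f])
  then show ?thesis using q(2) unfolding poly by (rule LIMSEQ_unique[rotated])
qed

end

section \<open>Inverses of self-adjoint operators\<close>

text \<open>The projection theorem: a minimizing sequence for the distance from \<open>z\<close>
  converges in \<open>V\<close>, and the residual at its limit is orthogonal to \<open>V\<close>,
  hence 0.\<close>

lemma closed_subspace_eq_UNIV:
  fixes V :: "'a::{real_inner, complete_space} set"
  assumes "subspace V" "closed V" and orthogonal: "\<And>y. (\<And>v. v \<in> V \<Longrightarrow> v \<bullet> y = 0) \<Longrightarrow> y = 0"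
  shows "V = UNIV"
proof -
  have "z \<in> V" for z
  proof -
    define d where "d = infdist z V"
    have "V \<noteq> {}" using subspace_0[OF \<open>subspace V\<close>] by blast
    have d_le: "d \<le> norm (z - v)" if "v \<in> V" for v
      using infdist_le[OF that, of z] by (simp add: d_def dist_norm)
    have "d \<ge> 0" by (simp add: d_def infdist_nonneg)
    have "\<exists>v\<in>V. (norm (z - v))\<^sup>2 < d\<^sup>2 + 1 / real (Suc n)" for n
    proof -
      have "d < sqrt (d\<^sup>2 + 1 / real (Suc n))" by (rule real_less_rsqrt) simp
      then obtain v where "v \<in> V" "dist z v < sqrt (d\<^sup>2 + 1 / real (Suc n))"
        using cINF_less_iff[OF \<open>V \<noteq> {}\<close> bdd_below_image_dist, of z]
        by (auto simp: d_def infdist_notempty[OF \<open>V \<noteq> {}\<close>])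
      then have "(norm (z - v))\<^sup>2 < (sqrt (d\<^sup>2 + 1 / real (Suc n)))\<^sup>2"
        by (intro power_strict_mono) (simp_all add: dist_norm)
      then show ?thesis using \<open>v \<in> V\<close> by auto
    qed
    then obtain v where v: "\<And>n. v n \<in> V" "\<And>n. (norm (z - v n))\<^sup>2 < d\<^sup>2 + 1 / real (Suc n)"
      by metis
    \<comment> \<open>The parallelogram law, with the midpoint of \<open>v m\<close> and
      \<open>v n\<close> in \<open>V\<close> and so at distance at least \<open>d\<close> from
      \<open>z\<close>.\<close>
    have parallelogram: "(norm (v m - v n))\<^sup>2 \<le>
        2 * (norm (z - v m))\<^sup>2 + 2 * (norm (z - v n))\<^sup>2 - 4 * d\<^sup>2" for m n
    proof -
      have "(1/2) *\<^sub>R (v m + v n) \<in> V"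
        using v(1) \<open>subspace V\<close> by (intro subspace_scale subspace_add)
      then have "d\<^sup>2 \<le> (norm (z - (1/2) *\<^sub>R (v m + v n)))\<^sup>2"
        using d_le \<open>d \<ge> 0\<close> by (intro power_mono) auto
      then show ?thesis
        unfolding power2_norm_eq_inner by (simp add: inner_simps inner_commute algebra_simps)
    qed
    have "Cauchy v"
    proof (rule CauchyI)
      fix e :: real assume "e > 0"
      then obtain N where N: "1 / real (Suc N) < e\<^sup>2 / 4"
        using nat_approx_posE[of "e\<^sup>2 / 4"] by auto
      have "norm (v m - v n) < e" if "m \<ge> N" "n \<ge> N" for m n
      proof -
        have small: "(norm (z - v k))\<^sup>2 < d\<^sup>2 + e\<^sup>2 / 4" if "k \<ge> N" for k
        proof -
          have "1 / real (Suc k) \<le> 1 / real (Suc N)" using that by (simp add: frac_le)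
          then show ?thesis using v(2)[of k] N by linarith
        qed
        have "(norm (v m - v n))\<^sup>2 < e\<^sup>2"
          using parallelogram[of m n] small[OF \<open>m \<ge> N\<close>] small[OF \<open>n \<ge> N\<close>] by linarith
        then show ?thesis using \<open>e > 0\<close> by (simp add: power_less_imp_less_base)
      qed
      then show "\<exists>M. \<forall>m\<ge>M. \<forall>n\<ge>M. norm (v m - v n) < e" by blast
    qed
    then obtain u where u: "v \<longlonglongrightarrow> u" by (auto simp: Cauchy_convergent_iff convergent_def)
    have "u \<in> V" using closed_sequentially[OF \<open>closed V\<close>] v(1) u by blast
    have "(norm (z - u))\<^sup>2 \<le> d\<^sup>2 + 0"
    proof (rule LIMSEQ_le)
      show "(\<lambda>n. (norm (z - v n))\<^sup>2) \<longlonglongrightarrow> (norm (z - u))\<^sup>2"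
        by (intro tendsto_intros u)
      show "(\<lambda>n. d\<^sup>2 + 1 / real (Suc n)) \<longlonglongrightarrow> d\<^sup>2 + 0"
        using LIMSEQ_inverse_real_of_nat by (intro tendsto_intros) (simp add: inverse_eq_divide)
      show "\<exists>N. \<forall>n\<ge>N. (norm (z - v n))\<^sup>2 \<le> d\<^sup>2 + 1 / real (Suc n)"
        using v(2) less_imp_le by blast
    qed
    then have min: "(norm (z - u))\<^sup>2 \<le> (norm (z - x))\<^sup>2" if "x \<in> V" for x
      using power_mono[OF d_le[OF that] \<open>d \<ge> 0\<close>, of 2] by linarith
    have "z - u = 0"
    proof (rule orthogonal)
      fix x assume "x \<in> V"
      show "x \<bullet> (z - u) = 0"
      proof (cases "x = 0")
        case False
        \<comment> \<open>The coefficient of the projection of \<open>z - u\<close> onto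
          \<open>x\<close>. Moving \<open>u\<close> by this multiple of \<open>x\<close> would
          reduce the distance unless the inner product vanishes.\<close>
        define c where "c = x \<bullet> (z - u) / (x \<bullet> x)"
        have "u + c *\<^sub>R x \<in> V"
          using \<open>u \<in> V\<close> \<open>x \<in> V\<close> \<open>subspace V\<close> by (intro subspace_scale subspace_add)
        from min[OF this] have "(z - u) \<bullet> (z - u) \<le> ((z - u) - c *\<^sub>R x) \<bullet> ((z - u) - c *\<^sub>R x)"
          by (simp add: power2_norm_eq_inner diff_diff_eq)
        also have "(p - c *\<^sub>R x) \<bullet> (p - c *\<^sub>R x) = p \<bullet> p - 2 * c * (x \<bullet> p) + c\<^sup>2 * (x \<bullet> x)" for p
          by (simp add: inner_diff_left inner_diff_right inner_commute[of p x] power2_eq_square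
              right_diff_distrib)
        also have "c\<^sup>2 * (x \<bullet> x) = c * (x \<bullet> (z - u))"
          using False by (simp add: c_def power2_eq_square)
        finally have "c * (x \<bullet> (z - u)) \<le> 0" by simp
        have "(x \<bullet> (z - u))\<^sup>2 = c * (x \<bullet> (z - u)) * (x \<bullet> x)"
          using False by (simp add: c_def power2_eq_square)
        also have "\<dots> \<le> 0" using \<open>c * (x \<bullet> (z - u)) \<le> 0\<close> by (rule mult_nonpos_nonneg) simp
        finally have "(x \<bullet> (z - u))\<^sup>2 \<le> 0" .
        then show ?thesis by simp
      qed simp
    qed
    then show ?thesis using \<open>u \<in> V\<close> by simp
  qed
  then show ?thesis by blast
qed

locale bounded_below_self_adjoint =
  fixes D :: "'a::{real_inner, complete_space} set" and B :: "'a \<Rightarrow> 'a" and m :: real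
  assumes self_adjoint: "self_adjoint_on D B"
    and m_pos: "m > 0" and bounded_below: "x \<in> D \<Longrightarrow> norm (B x) \<ge> m * norm x"
begin

lemma subspace_domain: "subspace D"
  using self_adjoint by (simp add: self_adjoint_on_def densely_defined_linear_def)

lemma B_add: "x \<in> D \<Longrightarrow> y \<in> D \<Longrightarrow> B (x + y) = B x + B y"
  using self_adjoint by (simp add: self_adjoint_on_def densely_defined_linear_def)

lemma B_scaleR: "x \<in> D \<Longrightarrow> B (c *\<^sub>R x) = c *\<^sub>R B x"
  using self_adjoint by (simp add: self_adjoint_on_def densely_defined_linear_def)

lemma B_0: "B 0 = 0"
  using B_scaleR[of 0 0] subspace_0[OF subspace_domain] by simp

lemma B_diff: "x \<in> D \<Longrightarrow> y \<in> D \<Longrightarrow> B (x - y) = B x - B y"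
  using B_add[of x "- y"] B_scaleR[of y "-1"] subspace_neg[OF subspace_domain] by simp

lemma B_symmetric: "x \<in> D \<Longrightarrow> y \<in> D \<Longrightarrow> B x \<bullet> y = x \<bullet> B y"
  using self_adjoint unfolding self_adjoint_on_def by blast

text \<open>The half of self-adjointness that goes beyond symmetry. It shows both that the range of
  \<open>B\<close> is closed and that its orthogonal complement is trivial.\<close>

lemma adjoint_domain:
  assumes "\<And>x. x \<in> D \<Longrightarrow> B x \<bullet> y = x \<bullet> z"
  shows "y \<in> D" "B y = z"
  using self_adjoint assms unfolding self_adjoint_on_def by blast+

lemma inj_on_B: "inj_on B D"
proof (rule inj_onI)
  fix x y assume "x \<in> D" "y \<in> D" "B x = B y"
  then have "m * norm (x - y) \<le> 0"
    using bounded_below[of "x - y"] B_diff subspace_diff[OF subspace_domain] by simp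
  then show "x = y" using m_pos by (simp add: mult_le_0_iff)
qed

text \<open>The lower bound turns convergence of \<open>B (x n)\<close> into the Cauchy property of
  \<open>x n\<close>; testing the limit against \<open>D\<close> places it in the domain of the
  adjoint, which is \<open>D\<close>.\<close>

lemma closed_range: "closed (B ` D)"
proof -
  have limit: "z \<in> B ` D" if "\<And>n. x n \<in> D" and z: "(\<lambda>n. B (x n)) \<longlonglongrightarrow> z" for x z
  proof -
    have "Cauchy x"
    proof (rule CauchyI)
      fix e :: real assume "e > 0"
      then obtain N where N: "\<And>k n. k \<ge> N \<Longrightarrow> n \<ge> N \<Longrightarrow> norm (B (x k) - B (x n)) < m * e"
        using CauchyD[OF LIMSEQ_imp_Cauchy[OF z], of "m * e"] m_pos by auto
      have "norm (x k - x n) < e" if "k \<ge> N" "n \<ge> N" for k n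
      proof -
        have "m * norm (x k - x n) \<le> norm (B (x k) - B (x n))"
          using bounded_below[of "x k - x n"] \<open>\<And>n. x n \<in> D\<close> subspace_diff[OF subspace_domain]
          by (simp add: B_diff)
        also have "\<dots> < m * e" using N[OF that] .
        finally show ?thesis using m_pos by simp
      qed
      then show "\<exists>M. \<forall>k\<ge>M. \<forall>n\<ge>M. norm (x k - x n) < e" by blast
    qed
    then obtain u where u: "x \<longlonglongrightarrow> u" by (auto simp: Cauchy_convergent_iff convergent_def)
    have "B v \<bullet> u = v \<bullet> z" if "v \<in> D" for v
    proof (rule LIMSEQ_unique)
      show "(\<lambda>n. B v \<bullet> x n) \<longlonglongrightarrow> B v \<bullet> u" by (intro tendsto_intros u)
      show "(\<lambda>n. B v \<bullet> x n) \<longlonglongrightarrow> v \<bullet> z"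
        using B_symmetric[OF that \<open>\<And>n. x n \<in> D\<close>] by (simp add: tendsto_intros z)
    qed
    then have "u \<in> D" "B u = z" by (auto intro: adjoint_domain)
    then show ?thesis by blast
  qed
  show ?thesis
    unfolding closed_sequential_limits
  proof safe
    fix y z assume "\<forall>n. y n \<in> B ` D" and "y \<longlonglongrightarrow> z"
    then obtain x where "\<And>n. x n \<in> D" "y = (\<lambda>n. B (x n))"
      by (metis (no_types, lifting) ext image_iff)
    then show "z \<in> B ` D" using limit[of x z] \<open>y \<longlonglongrightarrow> z\<close> by simp
  qed
qed

text \<open>A vector orthogonal to the range lies in the kernel of the adjoint, that is of
  \<open>B\<close>, and the lower bound makes this kernel trivial.\<close>

lemma range_eq_UNIV: "B ` D = UNIV"
proof (rule closed_subspace_eq_UNIV[OF _ closed_range])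
  show "subspace (B ` D)"
  proof (rule subspaceI)
    show "0 \<in> B ` D" using B_0 subspace_0[OF subspace_domain] by (metis imageI)
    show "x + y \<in> B ` D" if xy: "x \<in> B ` D" "y \<in> B ` D" for x y
    proof -
      obtain a b where "a \<in> D" "b \<in> D" "x = B a" "y = B b" using xy by blast
      then show ?thesis
        using subspace_add[OF subspace_domain] by (intro image_eqI[of _ _ "a + b"]) (simp_all add: B_add)
    qed
    show "c *\<^sub>R x \<in> B ` D" if x: "x \<in> B ` D" for c x
    proof -
      obtain a where "a \<in> D" "x = B a" using x by blast
      then show ?thesis
        using subspace_scale[OF subspace_domain] by (intro image_eqI[of _ _ "c *\<^sub>R a"]) (simp_all add: B_scaleR)
    qed
  qed
  fix y assume "\<And>v. v \<in> B ` D \<Longrightarrow> v \<bullet> y = 0"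
  then have y: "y \<in> D" "B y = 0" using adjoint_domain[of y 0] by auto
  then show "y = 0" using bounded_below[of y] m_pos by (simp add: mult_le_0_iff)
qed

abbreviation "A \<equiv> inverse_operator D B"

text \<open>\<open>Blinfun\<close> returns the given function only if it is bounded and linear; here
  the bound is \<open>1 / m\<close>.\<close>

lemma inverse_operator_apply: "A y = inv_into D B y"
proof -
  have in_D: "inv_into D B y \<in> D" for y by (simp add: inv_into_into range_eq_UNIV)
  have B_inv: "B (inv_into D B y) = y" for y by (simp add: f_inv_into_f range_eq_UNIV)
  have "bounded_linear (inv_into D B)"
  proof (rule bounded_linear_intro)
    show "inv_into D B (x + y) = inv_into D B x + inv_into D B y" for x y
      using inj_on_B in_D by (intro inv_into_f_eq) (simp_all add: B_add B_inv subspace_add subspace_domain)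
    show "inv_into D B (c *\<^sub>R x) = c *\<^sub>R inv_into D B x" for c x
      using inj_on_B in_D by (intro inv_into_f_eq) (simp_all add: B_scaleR B_inv subspace_scale subspace_domain)
    show "norm (inv_into D B x) \<le> norm x * (1 / m)" for x
      using bounded_below[OF in_D[of x]] m_pos by (simp add: B_inv field_simps)
  qed
  then show ?thesis by (simp add: inverse_operator_def bounded_linear_Blinfun_apply)
qed

lemma inverse_operator_in_domain: "A y \<in> D"
  by (simp add: inverse_operator_apply inv_into_into range_eq_UNIV)

lemma B_inverse_operator: "B (A y) = y"
  by (simp add: inverse_operator_apply f_inv_into_f range_eq_UNIV)

lemma inverse_operator_B: "x \<in> D \<Longrightarrow> A (B x) = x"
  by (simp add: inverse_operator_apply inv_into_f_f inj_on_B)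

sublocale symmetric_operator A
  by unfold_locales (metis B_symmetric B_inverse_operator inverse_operator_in_domain)

end

section \<open>Index functions\<close>

text \<open>Sub-linearity of the \<open>q\<close>-th power says that \<open>\<psi>\<close> grows at
  most like \<open>t powr (1 / q)\<close> on \<open>{0<..t0}\<close>. Between \<open>t0\<close> and
  \<open>b\<close> the constant \<open>C\<close> absorbs the growth.\<close>

lemma index_function_growth:
  assumes \<psi>: "index_function \<psi>" and sub: "sub_linear (\<lambda>t. \<psi> t powr q)" and "q > 0"
  obtains C t0 where "C \<ge> 1" "t0 > 0"
    "\<And>\<alpha> t. 0 < \<alpha> \<Longrightarrow> \<alpha> \<le> t0 \<Longrightarrow> \<alpha> \<le> t \<Longrightarrow> t \<le> b \<Longrightarrow> \<psi> t \<le> C * (t / \<alpha>) powr (1 / q) * \<psi> \<alpha>"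
proof -
  have pos: "\<psi> t > 0" if "t > 0" for t using \<psi> that by (simp add: index_function_def)
  have mono: "\<psi> s \<le> \<psi> t" if "0 < s" "s \<le> t" for s t
    using \<psi> that by (simp add: index_function_def mono_on_def)
  obtain t0 where "t0 > 0" and t0: "mono_on {0<..t0} (\<lambda>t. t / \<psi> t powr q)"
    using sub by (auto simp: sub_linear_def)
  \<comment> \<open>The maximum covers the case \<open>b < t0\<close> and gives
    \<open>C \<ge> 1\<close>.\<close>
  define C where "C = \<psi> (max b t0) / \<psi> t0"
  have "C \<ge> 1" using \<open>t0 > 0\<close> pos mono by (simp add: C_def)
  have near: "\<psi> t \<le> (t / \<alpha>) powr (1 / q) * \<psi> \<alpha>" if "0 < \<alpha>" "\<alpha> \<le> t" "t \<le> t0" for \<alpha> t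
  proof -
    have "\<alpha> / \<psi> \<alpha> powr q \<le> t / \<psi> t powr q" using t0 that by (simp add: mono_on_def)
    then have "\<psi> t powr q \<le> t / \<alpha> * \<psi> \<alpha> powr q"
      using that pos[of \<alpha>] pos[of t] by (simp add: field_simps)
    then have "(\<psi> t powr q) powr (1 / q) \<le> (t / \<alpha> * \<psi> \<alpha> powr q) powr (1 / q)"
      using \<open>q > 0\<close> by (intro powr_mono2) auto
    moreover have "(t / \<alpha> * \<psi> \<alpha> powr q) powr (1 / q) = (t / \<alpha>) powr (1 / q) * \<psi> \<alpha>"
      using that \<open>q > 0\<close> pos[of \<alpha>] by (subst powr_mult) (auto simp: powr_powr)
    ultimately show ?thesis
      using \<open>q > 0\<close> pos[of t] that by (simp add: powr_powr)
  qed
  have "\<psi> t \<le> C * (t / \<alpha>) powr (1 / q) * \<psi> \<alpha>" if "0 < \<alpha>" "\<alpha> \<le> t0" "\<alpha> \<le> t" "t \<le> b" for \<alpha> t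
  proof (cases "t \<le> t0")
    case True
    then have "\<psi> t \<le> 1 * ((t / \<alpha>) powr (1 / q) * \<psi> \<alpha>)" using near that by simp
    also have "\<dots> \<le> C * ((t / \<alpha>) powr (1 / q) * \<psi> \<alpha>)"
      using \<open>C \<ge> 1\<close> pos[of \<alpha>] that by (intro mult_right_mono) auto
    finally show ?thesis by (simp add: mult.assoc)
  next
    case False
    have "\<psi> t \<le> C * \<psi> t0"
      using mono[of t "max b t0"] that pos[OF \<open>t0 > 0\<close>] by (simp add: C_def)
    also have "\<dots> \<le> C * ((t0 / \<alpha>) powr (1 / q) * \<psi> \<alpha>)"
      using near[of \<alpha> t0] that \<open>C \<ge> 1\<close> by (intro mult_left_mono) auto
    also have "\<dots> \<le> C * ((t / \<alpha>) powr (1 / q) * \<psi> \<alpha>)"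
      using that False \<open>C \<ge> 1\<close> \<open>t0 > 0\<close> \<open>q > 0\<close> pos[of \<alpha>]
      by (intro mult_left_mono mult_right_mono powr_mono2 divide_right_mono) auto
    finally show ?thesis by (simp add: mult.assoc)
  qed
  then show ?thesis using that \<open>C \<ge> 1\<close> \<open>t0 > 0\<close> by blast
qed

text \<open>Below \<open>\<alpha>\<close> the numerator is monotone and the denominator is at least
  \<open>\<alpha>\<close>. Above \<open>\<alpha>\<close> the denominator is at least
  \<open>t\<close> and the growth bound applies. The upper bound on \<open>e\<close> is the
  qualification up to which the filter gives the full rate.\<close>

lemma index_function_filter_bound:
  assumes \<psi>: "index_function \<psi>" and "sub_linear (\<lambda>t. \<psi> t powr q)" and "q > 0"
  obtains C t0 where "C \<ge> 1" "t0 > 0"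
    "\<And>\<alpha> t e. 0 < \<alpha> \<Longrightarrow> \<alpha> \<le> t0 \<Longrightarrow> 0 < t \<Longrightarrow> t \<le> b \<Longrightarrow> 0 \<le> e \<Longrightarrow> e \<le> 1 - 1 / q \<Longrightarrow>
      t powr e * \<psi> t / (t + \<alpha>) \<le> C * \<psi> \<alpha> * \<alpha> powr (e - 1)"
proof -
  obtain C t0 where C: "C \<ge> 1" "t0 > 0" and growth:
    "\<And>\<alpha> t. 0 < \<alpha> \<Longrightarrow> \<alpha> \<le> t0 \<Longrightarrow> \<alpha> \<le> t \<Longrightarrow> t \<le> b \<Longrightarrow> \<psi> t \<le> C * (t / \<alpha>) powr (1 / q) * \<psi> \<alpha>"
    using index_function_growth[OF assms] by blast
  have pos: "\<psi> t > 0" if "t > 0" for t using \<psi> that by (simp add: index_function_def)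
  have "t powr e * \<psi> t / (t + \<alpha>) \<le> C * \<psi> \<alpha> * \<alpha> powr (e - 1)"
    if h: "0 < \<alpha>" "\<alpha> \<le> t0" "0 < t" "t \<le> b" "0 \<le> e" "e \<le> 1 - 1 / q" for \<alpha> t e
  proof (cases "t \<le> \<alpha>")
    case True
    have "\<psi> t \<le> 1 * \<psi> \<alpha>" using \<psi> h True by (simp add: index_function_def mono_on_def)
    also have "\<dots> \<le> C * \<psi> \<alpha>" using C pos[of \<alpha>] h by (intro mult_right_mono) auto
    finally have "t powr e * \<psi> t / (t + \<alpha>) \<le> \<alpha> powr e * (C * \<psi> \<alpha>) / \<alpha>"
      using h True pos[of t] C pos[of \<alpha>] by (intro frac_le mult_mono powr_mono2) auto
    also have "\<dots> = C * \<psi> \<alpha> * \<alpha> powr (e - 1)" using h by (simp add: powr_diff)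
    finally show ?thesis .
  next
    case False
    have "t powr e * \<psi> t / (t + \<alpha>) \<le> t powr e * (C * (t / \<alpha>) powr (1 / q) * \<psi> \<alpha>) / t"
      using growth[of \<alpha> t] h False pos[of t] C pos[of \<alpha>] by (intro frac_le mult_mono) auto
    also have "\<dots> = C * \<psi> \<alpha> * \<alpha> powr e * (t / \<alpha>) powr (e + 1 / q) / t"
      using h by (simp add: powr_add powr_divide)
    \<comment> \<open>The restriction on \<open>e\<close> enters here:
      \<open>e + 1 / q \<le> 1\<close> while \<open>t / \<alpha> \<ge> 1\<close>.\<close>
    also have "\<dots> \<le> C * \<psi> \<alpha> * \<alpha> powr e * (t / \<alpha>) powr 1 / t"
      using h False C pos[of \<alpha>] by (intro divide_right_mono mult_left_mono powr_mono) auto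
    also have "\<dots> = C * \<psi> \<alpha> * \<alpha> powr (e - 1)" using h by (simp add: powr_diff)
    finally show ?thesis .
  qed
  then show ?thesis using that C by blast
qed

lemma continuous_on_index_function_extension:
  assumes "index_function \<psi>"
  shows "continuous_on S (\<lambda>t. if 0 < t then \<psi> t else 0)" (is "continuous_on S ?f")
proof -
  have "isCont ?f t" for t
  proof (cases t "0 :: real" rule: linorder_cases)
    case less
    have "\<forall>\<^sub>F x in nhds t. ?f x = 0"
      using eventually_nhds_in_open[of "{..<0}" t] less by (auto elim!: eventually_mono)
    then show ?thesis using less by (subst isCont_cong) auto
  next
    case greater
    have "\<forall>\<^sub>F x in nhds t. ?f x = \<psi> x"
      using eventually_nhds_in_open[of "{0<..}" t] greater by (auto elim!: eventually_mono)
    moreover have "isCont \<psi> t"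
      using assms greater by (simp add: index_function_def continuous_on_eq_continuous_at)
    ultimately show ?thesis by (subst isCont_cong) auto
  next
    case equal
    have "(?f \<longlongrightarrow> 0) (at_right 0)"
      using assms by (subst filterlim_cong[where g = \<psi>])
        (auto simp: index_function_def eventually_at_filter)
    moreover have "(?f \<longlongrightarrow> 0) (at_left 0)"
      by (rule tendsto_eventually) (auto simp: eventually_at_filter)
    ultimately have "(?f \<longlongrightarrow> 0) (at 0)" by (simp add: filterlim_split_at)
    then show ?thesis using equal by (simp add: isCont_def)
  qed
  then show ?thesis by (simp add: continuous_at_imp_continuous_on)
qed

section \<open>Smoothed approximations and interpolation\<close>

text \<open>The convex function \<open>u powr (a + 1)\<close> lies above its tangent at 1; this is
  Young's inequality with second factor 1.\<close>

lemma powr_ge_tangent: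
  fixes u a :: real
  assumes "u \<ge> 0" "a > 0"
  shows "u \<le> u powr (a + 1) / (a + 1) + (1 - 1 / (a + 1))"
proof (cases "u = 0")
  case False
  have "(u powr (a + 1)) powr (1 / (a + 1)) * 1 powr (1 - 1 / (a + 1))
      \<le> 1 / (a + 1) * u powr (a + 1) + (1 - 1 / (a + 1)) * 1"
    using assms False by (intro Youngs_inequality_0) auto
  then show ?thesis using assms by (simp add: powr_powr)
qed (use assms in simp)

context symmetric_operator
begin

text \<open>Applied with \<open>v = B x\<close>, so that \<open>A v = x\<close> is measured between
  the scale norms of orders \<open>-a\<close> and 1. A pointwise Young inequality between the
  symbols becomes one between the quadratic forms, and its weights add up so that no constant is
  lost.\<close>

lemma interpolation:
  assumes "a > 0" "\<alpha> > 0" "E \<ge> 0"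
    and neg: "norm (spectral_calculus (\<lambda>t. \<bar>t\<bar> powr a) A (A v)) \<le> E"
    and pos: "norm v \<le> E / sqrt \<alpha>"
  shows "norm (A v) \<le> E * \<alpha> powr (- a / (2 * a + 2))"
proof -
  define q where "q = 2 * a + 2"
  define \<theta> where "\<theta> = 1 / (a + 1)"
  \<comment> \<open>Chosen so that \<open>s powr (a + 1) = \<alpha>\<close>, which lets the two
    hypotheses contribute the shares \<open>\<theta>\<close> and \<open>1 - \<theta>\<close> of the
    same quantity \<open>s / \<alpha> * E\<^sup>2\<close>.\<close>
  define s where "s = \<alpha> powr (2 / q)"
  have "q > 0" "0 < \<theta>" "\<theta> < 1" "s > 0" using assms by (auto simp: q_def \<theta>_def s_def)
  have c1: "continuous_on I (\<lambda>t. (\<bar>t\<bar> powr a * t)\<^sup>2)" and c2: "continuous_on I (\<lambda>t. \<bar>t\<bar> powr a * t)"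
    and c3: "continuous_on I (\<lambda>t. \<bar>t\<bar> powr a)"
    using \<open>a > 0\<close> by (intro continuous_intros; simp)+
  have c4: "continuous_on I (\<lambda>t. s * \<theta> / \<alpha> * (\<bar>t\<bar> powr a * t)\<^sup>2 + s * (1 - \<theta>))"
    by (rule continuous_on_add[OF continuous_on_mult_left[OF c1] continuous_on_const])
  have young: "t\<^sup>2 \<le> s * \<theta> / \<alpha> * (\<bar>t\<bar> powr a * t)\<^sup>2 + s * (1 - \<theta>)" for t :: real
  proof (cases "t = 0")
    case False
    have "(t\<^sup>2 / s) powr (a + 1) = (\<bar>t\<bar> powr a * t)\<^sup>2 / \<alpha>"
    proof -
      have "(t\<^sup>2) powr (a + 1) = (\<bar>t\<bar> powr 2) powr (a + 1)" using False by simp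
      also have "\<dots> = \<bar>t\<bar> powr (a + a) * \<bar>t\<bar> powr 2" unfolding powr_powr powr_add[symmetric]
        by (simp add: algebra_simps)
      also have "\<dots> = (\<bar>t\<bar> powr a * t)\<^sup>2"
        unfolding powr_add using False by (simp add: power_mult_distrib power2_eq_square)
      moreover have "s powr (a + 1) = \<alpha>"
        using assms \<open>q > 0\<close> by (simp add: s_def powr_powr q_def field_simps)
      ultimately show ?thesis using \<open>s > 0\<close> by (simp add: powr_divide)
    qed
    then have "t\<^sup>2 / s \<le> \<theta> * ((\<bar>t\<bar> powr a * t)\<^sup>2 / \<alpha>) + (1 - \<theta>)"
      using powr_ge_tangent[of "t\<^sup>2 / s" a] \<open>s > 0\<close> \<open>a > 0\<close> 
      by (simp add: \<theta>_def mult.commute[of \<alpha>])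
    then show ?thesis using \<open>s > 0\<close> by (simp add: field_simps)
  qed (use \<open>s > 0\<close> \<open>\<theta> < 1\<close> in simp)
  have "(norm (A v))\<^sup>2 = spectral_calculus (\<lambda>t. t\<^sup>2) A v \<bullet> v"
    using power2_norm_spectral_calculus[of "\<lambda>t. t" v] by (simp add: spectral_calculus_ident)
  also have "\<dots> \<le> spectral_calculus (\<lambda>t. s * \<theta> / \<alpha> * (\<bar>t\<bar> powr a * t)\<^sup>2 + s * (1 - \<theta>)) A v \<bullet> v"
    using young c4 by (intro spectral_calculus_form_mono continuous_on_power continuous_on_id)
  also have "spectral_calculus (\<lambda>t. s * \<theta> / \<alpha> * (\<bar>t\<bar> powr a * t)\<^sup>2 + s * (1 - \<theta>)) A =
      (s * \<theta> / \<alpha>) *\<^sub>R spectral_calculus (\<lambda>t. (\<bar>t\<bar> powr a * t)\<^sup>2) A + (s * (1 - \<theta>)) *\<^sub>R id_blinfun"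
    unfolding spectral_calculus_add[OF continuous_on_mult_left[OF c1] continuous_on_const]
      spectral_calculus_scale[OF c1] spectral_calculus_const ..
  also have "\<dots> v \<bullet> v = s * \<theta> / \<alpha> * (norm (spectral_calculus (\<lambda>t. \<bar>t\<bar> powr a * t) A v))\<^sup>2
      + s * (1 - \<theta>) * (norm v)\<^sup>2"
    by (simp add: blinfun.bilinear_simps inner_simps power2_norm_spectral_calculus[OF c2])
      (simp add: power2_norm_eq_inner)
  also have "spectral_calculus (\<lambda>t. \<bar>t\<bar> powr a * t) A v = spectral_calculus (\<lambda>t. \<bar>t\<bar> powr a) A (A v)"
    by (subst spectral_calculus_mult) (simp_all add: c3 spectral_calculus_ident)
  also have "s * \<theta> / \<alpha> * (norm (spectral_calculus (\<lambda>t. \<bar>t\<bar> powr a) A (A v)))\<^sup>2 + s * (1 - \<theta>) * (norm v)\<^sup>2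
      \<le> s * \<theta> / \<alpha> * E\<^sup>2 + s * (1 - \<theta>) * (E / sqrt \<alpha>)\<^sup>2"
    using neg pos \<open>s > 0\<close> \<open>0 < \<theta>\<close> \<open>\<theta> < 1\<close> \<open>\<alpha> > 0\<close> by (intro add_mono mult_left_mono power_mono) auto
  also have "\<dots> = s / \<alpha> * E\<^sup>2"
    using \<open>\<alpha> > 0\<close> by (simp add: power_divide field_simps)
  also have "s / \<alpha> = (\<alpha> powr (- a / (2 * a + 2)))\<^sup>2"
  proof -
    have "s / \<alpha> = \<alpha> powr (2 / q - 1)" using \<open>\<alpha> > 0\<close> by (simp add: s_def powr_diff)
    also have "2 / q - 1 = 2 * (- a / (2 * a + 2))" using \<open>q > 0\<close> by (simp add: q_def field_simps)
    finally show ?thesis by (simp only: mult_2 powr_add power2_eq_square)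
  qed
  also have "(\<alpha> powr (- a / (2 * a + 2)))\<^sup>2 * E\<^sup>2 = (E * \<alpha> powr (- a / (2 * a + 2)))\<^sup>2"
    by (simp add: power_mult_distrib)
  finally show ?thesis using \<open>E \<ge> 0\<close> by (simp add: power2_le_iff_abs_le)
qed

text \<open>Rewrites the operator of the source condition, a function of \<open>G\<close>, as a
  function of \<open>A\<close>, so that all estimates take place in one calculus.\<close>

lemma index_operator_eq:
  assumes "s > 0" "index_function \<psi>"
  shows "index_operator \<psi> (spectral_calculus (\<lambda>t. \<bar>t\<bar> powr s) A) =
    spectral_calculus (\<lambda>t. if 0 < \<bar>t\<bar> powr s then \<psi> (\<bar>t\<bar> powr s) else 0) A"
  unfolding index_operator_def
proof (rule spectral_calculus_compose)
  fix t assume "t \<in> I"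
  then have "\<bar>t\<bar> powr s \<le> norm A powr s" using \<open>s > 0\<close> by (intro powr_mono2) auto
  also have "\<dots> \<le> norm (spectral_calculus (\<lambda>t. \<bar>t\<bar> powr s) A)" using \<open>s > 0\<close> by (rule norm_powr_le)
  finally show "\<bar>\<bar>t\<bar> powr s\<bar> \<le> norm (spectral_calculus (\<lambda>t. \<bar>t\<bar> powr s) A)" by simp
qed (use assms in \<open>auto intro: continuous_intros continuous_on_index_function_extension\<close>)

text \<open>
  The witness is \<open>v = B(x\<^sub>\<alpha> - xbar)\<close> for the minimizer \<open>x\<^sub>\<alpha>\<close> of the linearized functional
  \<open>\<parallel>x - xdag\<parallel>\<^bsub>-a\<^esub>\<^sup>2 + \<alpha> \<parallel>B(x - xbar)\<parallel>\<^sup>2\<close>, that is, \<open>A v = G (G + \<alpha>)\<^sup>-\<^sup>1 (xdag - xbar)\<close>.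
\<close>
lemma smoothed_approximation:
  fixes \<psi> :: "real \<Rightarrow> real" and w :: 'a
  assumes "a > 0" and \<psi>: "index_function \<psi>" and sub: "sub_linear (\<lambda>t. \<psi> t powr (2 * a + 2))"
  defines "g \<equiv> index_operator \<psi> (spectral_calculus (\<lambda>t. \<bar>t\<bar> powr (2 * a + 2)) A) w"
  obtains C t0 where "C > 0" "t0 > 0"
    "\<And>\<alpha>. 0 < \<alpha> \<Longrightarrow> \<alpha> \<le> t0 \<Longrightarrow> \<exists>v. norm (A v - g) \<le> C * \<psi> \<alpha>
      \<and> norm (spectral_calculus (\<lambda>t. \<bar>t\<bar> powr a) A (A v - g)) \<le> C * \<psi> \<alpha> * \<alpha> powr (a / (2 * a + 2))
      \<and> norm v \<le> C * \<psi> \<alpha> * \<alpha> powr (- 1 / (2 * a + 2))"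
proof -
  define q where "q = 2 * a + 2"
  have "q > 0" "q > 2" using \<open>a > 0\<close> by (auto simp: q_def)
  define h where "h = (\<lambda>t::real. \<bar>t\<bar> powr q)"
  define \<psi>0 where "\<psi>0 = (\<lambda>t. if 0 < t then \<psi> t else 0)"
  \<comment> \<open>\<open>h\<close> is the symbol of \<open>G\<close>, and
    \<open>- \<alpha> * r \<alpha>\<close> applied to \<open>w\<close> is the error of the
    linearized regularization. The three required estimates bound
    \<open>\<bar>t\<bar> powr k * \<bar>r \<alpha> t\<bar>\<close> with \<open>k = 0\<close>,
    \<open>k = a\<close> and \<open>k = q - 1\<close>.\<close>
  define r where "r = (\<lambda>\<alpha> t. \<psi>0 (h t) / (h t + \<alpha>))"
  have h_nonneg: "h t \<ge> 0" for t by (simp add: h_def)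
  have cont_h: "continuous_on S h" for S
    using \<open>q > 0\<close> unfolding h_def by (intro continuous_intros) auto
  have cont_\<psi>0: "continuous_on S (\<lambda>t. \<psi>0 (h t))" for S
    using continuous_on_compose2[OF continuous_on_index_function_extension[OF \<psi>, of UNIV] cont_h]
    by (simp add: \<psi>0_def)
  have cont_r: "continuous_on S (r \<alpha>)" if "\<alpha> > 0" for \<alpha> S
    unfolding r_def using that h_nonneg
    by (intro continuous_intros cont_h cont_\<psi>0) (metis add_nonneg_pos less_irrefl)
  have g: "g = spectral_calculus (\<lambda>t. \<psi>0 (h t)) A w"
    unfolding g_def \<psi>0_def h_def
    using index_operator_eq[OF \<open>q > 0\<close> \<psi>] by (simp only: q_def)
  obtain C t0 where "C \<ge> 1" "t0 > 0" and bound: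
    "\<And>\<alpha> t e. 0 < \<alpha> \<Longrightarrow> \<alpha> \<le> t0 \<Longrightarrow> 0 < t \<Longrightarrow> t \<le> h (norm A) \<Longrightarrow> 0 \<le> e \<Longrightarrow> e \<le> 1 - 1 / q \<Longrightarrow>
      t powr e * \<psi> t / (t + \<alpha>) \<le> C * \<psi> \<alpha> * \<alpha> powr (e - 1)"
    using index_function_filter_bound[OF \<psi> sub[folded q_def] \<open>q > 0\<close>] by blast
  have r_bound: "\<bar>t\<bar> powr k * \<bar>r \<alpha> t\<bar> \<le> C * \<psi> \<alpha> * \<alpha> powr (k / q - 1)"
    if "0 < \<alpha>" "\<alpha> \<le> t0" "t \<in> I" "0 \<le> k" "k \<le> q - 1" for \<alpha> t k
  proof (cases "t = 0")
    case True
    have "\<psi> \<alpha> > 0" using \<psi> \<open>0 < \<alpha>\<close> by (simp add: index_function_def)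
    then show ?thesis using True \<open>C \<ge> 1\<close> by (simp add: r_def \<psi>0_def h_def)
  next
    case False
    then have "h t > 0" by (simp add: h_def)
    then have "\<psi> (h t) > 0" using \<psi> by (simp add: index_function_def)
    have "h t \<le> h (norm A)" using that \<open>q > 0\<close> by (auto simp: h_def intro!: powr_mono2)
    moreover have "k / q \<le> 1 - 1 / q" using that \<open>q > 0\<close> by (simp add: field_simps)
    ultimately have "h t powr (k / q) * \<psi> (h t) / (h t + \<alpha>) \<le> C * \<psi> \<alpha> * \<alpha> powr (k / q - 1)"
      using that \<open>h t > 0\<close> \<open>q > 0\<close> by (intro bound) auto
    moreover have "h t powr (k / q) = \<bar>t\<bar> powr k" using \<open>q > 0\<close> by (simp add: h_def powr_powr)
    ultimately show ?thesis
      using \<open>h t > 0\<close> \<open>\<psi> (h t) > 0\<close> \<open>0 < \<alpha>\<close> by (simp add: r_def \<psi>0_def)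
  qed
  \<comment> \<open>The added 1 keeps the constant positive for \<open>w = 0\<close>.\<close>
  define K where "K = C * (norm w + 1)"
  have "K > 0" "C * norm w \<le> K" using \<open>C \<ge> 1\<close> by (auto simp: K_def algebra_simps add_pos_nonneg intro!: mult_pos_pos)
  have K_bound: "norm (spectral_calculus f A w) \<le> K * \<psi> \<alpha> * \<alpha> powr e"
    if "continuous_on I f" "\<And>t. t \<in> I \<Longrightarrow> \<bar>f t\<bar> \<le> C * \<psi> \<alpha> * \<alpha> powr e" "\<alpha> > 0" for f \<alpha> e
  proof -
    have "norm (spectral_calculus f A w) \<le> C * \<psi> \<alpha> * \<alpha> powr e * norm w"
      using that by (intro norm_spectral_calculus_apply_le)
    also have "\<dots> = (C * norm w) * (\<psi> \<alpha> * \<alpha> powr e)" by simp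
    also have "\<dots> \<le> K * (\<psi> \<alpha> * \<alpha> powr e)"
      using \<open>C * norm w \<le> K\<close> \<psi> \<open>\<alpha> > 0\<close> by (intro mult_right_mono) (auto simp: index_function_def less_imp_le)
    finally show ?thesis by (simp add: mult.assoc)
  qed
  have "\<exists>v. norm (A v - g) \<le> K * \<psi> \<alpha>
      \<and> norm (spectral_calculus (\<lambda>t. \<bar>t\<bar> powr a) A (A v - g)) \<le> K * \<psi> \<alpha> * \<alpha> powr (a / (2 * a + 2))
      \<and> norm v \<le> K * \<psi> \<alpha> * \<alpha> powr (- 1 / (2 * a + 2))" if "0 < \<alpha>" "\<alpha> \<le> t0" for \<alpha>
  proof -
    \<comment> \<open>The factor \<open>t\<close> keeps its sign, so that
      \<open>t * f t = h t * r \<alpha> t\<close> also for negative \<open>t\<close>, when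
      \<open>B\<close> is indefinite.\<close>
    define f where "f = (\<lambda>t. t * \<bar>t\<bar> powr (q - 2) * r \<alpha> t)"
    define v where "v = spectral_calculus f A w"
    note cont = cont_r[OF \<open>0 < \<alpha>\<close>]
    have cont_f: "continuous_on I f" and cont_a: "continuous_on I (\<lambda>t. \<bar>t\<bar> powr a)"
      using \<open>q > 2\<close> \<open>a > 0\<close> unfolding f_def by (intro continuous_intros cont; simp)+
    have cont_\<alpha>r: "continuous_on I (\<lambda>t. - \<alpha> * r \<alpha> t)" by (intro continuous_intros cont)
    have residual: "t * f t - \<psi>0 (h t) = - \<alpha> * r \<alpha> t" for t
    proof -
      have "t * f t = h t * r \<alpha> t"
      proof (cases "t = 0")
        case False
        have "t * t * \<bar>t\<bar> powr (q - 2) = h t"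
          using False by (simp add: h_def powr_diff flip: power2_eq_square)
        then show ?thesis by (simp add: f_def)
      qed (simp add: f_def h_def)
      moreover have "(h t + \<alpha>) * r \<alpha> t = \<psi>0 (h t)"
        using h_nonneg[of t] \<open>0 < \<alpha>\<close> by (simp add: r_def)
      ultimately show ?thesis by (simp add: algebra_simps)
    qed
    have "A v = spectral_calculus (\<lambda>t. t * f t) A w"
      by (subst spectral_calculus_mult) (simp_all add: cont_f v_def spectral_calculus_ident)
    then have "A v - g = spectral_calculus (\<lambda>t. t * f t - \<psi>0 (h t)) A w"
      by (subst spectral_calculus_diff)
        (auto simp: g blinfun.bilinear_simps intro!: continuous_intros cont_f cont_\<psi>0)
    then have Av: "A v - g = spectral_calculus (\<lambda>t. - \<alpha> * r \<alpha> t) A w"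
      unfolding residual .
    have "norm (A v - g) \<le> K * \<psi> \<alpha> * \<alpha> powr 0"
      unfolding Av
    proof (rule K_bound)
      fix t assume "t \<in> I"
      \<comment> \<open>The point \<open>t = 0\<close> is treated separately since
        \<open>0 powr 0 = 0\<close>; there \<open>r\<close> vanishes.\<close>
      then have "\<bar>r \<alpha> t\<bar> \<le> C * \<psi> \<alpha> * (1 / \<alpha>)"
        using r_bound[of \<alpha> t 0] that \<open>q > 2\<close>
        by (cases "t = 0") (simp_all add: powr_minus_divide r_def \<psi>0_def h_def)
      then show "\<bar>- \<alpha> * r \<alpha> t\<bar> \<le> C * \<psi> \<alpha> * \<alpha> powr 0"
        using \<open>0 < \<alpha>\<close> by (simp add: abs_mult field_simps)
    qed (use cont_\<alpha>r \<open>0 < \<alpha>\<close> in auto)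
    moreover have "norm (spectral_calculus (\<lambda>t. \<bar>t\<bar> powr a) A (A v - g)) \<le> K * \<psi> \<alpha> * \<alpha> powr (a / q)"
    proof -
      have "spectral_calculus (\<lambda>t. \<bar>t\<bar> powr a) A (A v - g) =
          spectral_calculus (\<lambda>t. \<bar>t\<bar> powr a * (- \<alpha> * r \<alpha> t)) A w"
        unfolding Av by (subst spectral_calculus_mult) (simp_all only: cont_a cont_\<alpha>r blinfun_apply_blinfun_compose)
      also have "norm \<dots> \<le> K * \<psi> \<alpha> * \<alpha> powr (a / q)"
      proof (rule K_bound[OF continuous_on_mult[OF cont_a cont_\<alpha>r] _ \<open>0 < \<alpha>\<close>])
        fix t assume "t \<in> I"
        then have "\<alpha> * (\<bar>t\<bar> powr a * \<bar>r \<alpha> t\<bar>) \<le> \<alpha> * (C * \<psi> \<alpha> * \<alpha> powr (a / q - 1))"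
          using r_bound[of \<alpha> t a] that \<open>a > 0\<close> by (intro mult_left_mono) (auto simp: q_def)
        also have "\<dots> = C * \<psi> \<alpha> * \<alpha> powr (a / q)" using \<open>0 < \<alpha>\<close> by (simp add: powr_diff)
        finally show "\<bar>\<bar>t\<bar> powr a * (- \<alpha> * r \<alpha> t)\<bar> \<le> C * \<psi> \<alpha> * \<alpha> powr (a / q)"
          using \<open>0 < \<alpha>\<close> by (simp add: abs_mult mult.left_commute)
      qed
      finally show ?thesis .
    qed
    moreover have "norm v \<le> K * \<psi> \<alpha> * \<alpha> powr (- 1 / q)"
      unfolding v_def
    proof (rule K_bound)
      fix t assume "t \<in> I"
      have "\<bar>f t\<bar> = \<bar>t\<bar> powr (q - 1) * \<bar>r \<alpha> t\<bar>"
      proof (cases "t = 0")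
        case False
        have "1 + (q - 2) = q - 1" by simp
        then have "\<bar>t\<bar> * \<bar>t\<bar> powr (q - 2) = \<bar>t\<bar> powr (q - 1)"
          by (metis abs_ge_zero powr_mult_base)
        then show ?thesis by (simp add: f_def abs_mult)
      qed (simp add: f_def)
      \<comment> \<open>\<open>k = q - 1\<close> is the largest exponent that sub-linearity
        permits.\<close>
      also have "\<dots> \<le> C * \<psi> \<alpha> * \<alpha> powr ((q - 1) / q - 1)"
        using \<open>t \<in> I\<close> that \<open>q > 2\<close> by (intro r_bound) auto
      also have "(q - 1) / q - 1 = - 1 / q" using \<open>q > 0\<close> by (simp add: field_simps)
      finally show "\<bar>f t\<bar> \<le> C * \<psi> \<alpha> * \<alpha> powr (- 1 / q)" .
    qed (use cont_f \<open>0 < \<alpha>\<close> in auto)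
    ultimately show ?thesis using \<open>0 < \<alpha>\<close> by (auto simp: q_def)
  qed
  then show ?thesis using that \<open>K > 0\<close> \<open>t0 > 0\<close> by blast
qed

end

section \<open>Tikhonov regularization\<close>

text \<open>Minimality bounds the residual and the penalty of \<open>x\<close> by those of
  \<open>z\<close>, and interpolation of \<open>x - z\<close> turns both into an error bound. The
  comparison is with \<open>z\<close> because \<open>xdag\<close> may lie outside \<open>DB\<close>,
  where \<open>B (x - xdag)\<close> has no meaning.\<close>

lemma tikhonov_minimizer_error:
  fixes F :: "'x::{real_inner, complete_space} \<Rightarrow> 'y::real_inner"
  assumes B: "bounded_below_self_adjoint DB B m"
    and const: "a > 0" "0 < c\<^sub>a" "0 \<le> C\<^sub>a"
    and F: "\<And>x. x \<in> DF \<inter> DB \<Longrightarrow> c\<^sub>a * negative_norm DB B a (x - xdag) \<le> norm (F x - F xdag)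
             \<and> norm (F x - F xdag) \<le> C\<^sub>a * negative_norm DB B a (x - xdag)"
    and "xbar \<in> DB"
    and z: "z \<in> DF \<inter> DB" "negative_norm DB B a (z - xdag) \<le> P" "norm (B (z - xbar)) \<le> P / sqrt \<alpha>"
    and "\<alpha> > 0" and \<delta>: "norm (F xdag - yd) \<le> \<delta>"
    and x: "is_minimizer_on (DF \<inter> DB) (tikhonov F B xbar \<alpha> yd) x"
  shows "norm (x - z) \<le> max 1 (2 / c\<^sub>a) * ((C\<^sub>a + 2) * P + \<delta>) * \<alpha> powr (- a / (2 * a + 2))"
proof -
  interpret bounded_below_self_adjoint DB B m by fact
  define K where "K = max 1 (2 / c\<^sub>a)"
  \<comment> \<open>Large enough that \<open>(C\<^sub>a * P + \<delta>)\<^sup>2 + P\<^sup>2 \<le>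
    E\<^sup>2\<close>, with the noise level still entering with factor 1.\<close>
  define E where "E = (C\<^sub>a + 1) * P + \<delta>"
  have "K \<ge> 1" "2 / c\<^sub>a \<le> K" by (simp_all add: K_def)
  have "P \<ge> 0" using order_trans[OF norm_ge_zero z(2)[unfolded negative_norm_def]] .
  have "\<delta> \<ge> 0" using order_trans[OF norm_ge_zero \<delta>] .
  have "E \<ge> 0" using \<open>P \<ge> 0\<close> \<open>\<delta> \<ge> 0\<close> const by (simp add: E_def)
  have neg_diff: "negative_norm DB B a (u - v) \<le> negative_norm DB B a (u - t) + negative_norm DB B a (v - t)"
    for u v t
  proof -
    have "negative_power DB B a (u - v) =
        negative_power DB B a (u - t) - negative_power DB B a (v - t)"
      by (simp add: blinfun.bilinear_simps)
    then show ?thesis unfolding negative_norm_def by (simp only: norm_triangle_ineq4)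
  qed
  have xD: "x \<in> DF" "x \<in> DB" and min: "tikhonov F B xbar \<alpha> yd x \<le> tikhonov F B xbar \<alpha> yd z"
    using x z(1) by (auto simp: is_minimizer_on_def)
  have "tikhonov F B xbar \<alpha> yd z \<le> (C\<^sub>a * P + \<delta>)\<^sup>2 + P\<^sup>2"
  proof -
    have "norm (F z - F xdag) \<le> C\<^sub>a * P"
      using F[OF z(1)] mult_left_mono[OF z(2) const(3)] by linarith
    then have "norm (F z - yd) \<le> C\<^sub>a * P + \<delta>"
      using norm_triangle_ineq[of "F z - F xdag" "F xdag - yd"] \<delta> by simp
    moreover have "\<alpha> * (norm (B (z - xbar)))\<^sup>2 \<le> \<alpha> * (P / sqrt \<alpha>)\<^sup>2"
      using z(3) \<open>\<alpha> > 0\<close> by (intro mult_left_mono power_mono) auto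
    ultimately show ?thesis
      using \<open>\<alpha> > 0\<close> unfolding tikhonov_def by (intro add_mono power_mono) (auto simp: power_divide)
  qed
  also have "\<dots> \<le> E\<^sup>2"
  proof -
    have "E\<^sup>2 = (C\<^sub>a * P + \<delta>)\<^sup>2 + P\<^sup>2 + 2 * ((C\<^sub>a * P + \<delta>) * P)"
      by (simp add: E_def power2_eq_square algebra_simps)
    moreover have "0 \<le> (C\<^sub>a * P + \<delta>) * P" using \<open>P \<ge> 0\<close> \<open>\<delta> \<ge> 0\<close> const by simp
    ultimately show ?thesis by linarith
  qed
  finally have Tx: "(norm (F x - yd))\<^sup>2 + \<alpha> * (norm (B (x - xbar)))\<^sup>2 \<le> E\<^sup>2"
    using min by (simp add: tikhonov_def)
  have "(norm (F x - yd))\<^sup>2 \<le> E\<^sup>2"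
    using \<open>\<alpha> > 0\<close> by (intro order.trans[OF _ Tx]) simp
  then have Fx: "norm (F x - yd) \<le> E" using \<open>E \<ge> 0\<close> by (rule power2_le_imp_le)
  have "\<alpha> * (norm (B (x - xbar)))\<^sup>2 \<le> E\<^sup>2"
    by (rule order.trans[OF _ Tx]) simp
  then have "(norm (B (x - xbar)))\<^sup>2 \<le> (E / sqrt \<alpha>)\<^sup>2"
    using \<open>\<alpha> > 0\<close> by (simp add: power_divide field_simps)
  then have Bx: "norm (B (x - xbar)) \<le> E / sqrt \<alpha>"
    by (rule power2_le_imp_le) (use \<open>E \<ge> 0\<close> \<open>\<alpha> > 0\<close> in simp)
  have total: "(C\<^sub>a + 2) * P + \<delta> = E + P" by (simp add: E_def algebra_simps)
  have neg: "negative_norm DB B a (x - z) \<le> K * (E + P)"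
  proof -
    have "c\<^sub>a * negative_norm DB B a (x - xdag) \<le> E + \<delta>"
      using F[of x] xD norm_triangle_ineq4[of "F x - yd" "F xdag - yd"] Fx \<delta> by simp
    then have "negative_norm DB B a (x - xdag) \<le> (E + \<delta>) / c\<^sub>a"
      using const by (simp add: field_simps)
    \<comment> \<open>The noise occurs twice, in the residual of \<open>x\<close> and in
      \<open>yd\<close> itself; \<open>E + \<delta> \<le> 2 * E\<close> is the origin of the 2 in
      \<open>2 / c\<^sub>a\<close>.\<close>
    also have "\<dots> \<le> 2 / c\<^sub>a * E"
      using const \<open>P \<ge> 0\<close> by (simp add: E_def divide_right_mono)
    also have "\<dots> \<le> K * E" using \<open>2 / c\<^sub>a \<le> K\<close> \<open>E \<ge> 0\<close> by (rule mult_right_mono)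
    finally have "negative_norm DB B a (x - z) \<le> K * E + P"
      using neg_diff[of x z xdag] z(2) by linarith
    also have "\<dots> \<le> K * E + K * P" using \<open>K \<ge> 1\<close> \<open>P \<ge> 0\<close> mult_right_mono[of 1 K P] by simp
    finally show ?thesis by (simp add: distrib_left)
  qed
  \<comment> \<open>The penalty needs only the factor 1, which accounts for the 1 in the maximum
    \<open>K\<close>.\<close>
  have pos: "norm (B (x - z)) \<le> K * (E + P) / sqrt \<alpha>"
  proof -
    have "B (x - z) = B (x - xbar) - B (z - xbar)"
      using xD z(1) \<open>xbar \<in> DB\<close> by (simp add: B_diff)
    then have "norm (B (x - z)) \<le> E / sqrt \<alpha> + P / sqrt \<alpha>"
      using norm_triangle_ineq4[of "B (x - xbar)" "B (z - xbar)"] Bx z(3) by simp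
    also have "\<dots> = 1 * (E + P) / sqrt \<alpha>" by (simp add: add_divide_distrib)
    also have "\<dots> \<le> K * (E + P) / sqrt \<alpha>"
      using \<open>K \<ge> 1\<close> \<open>E \<ge> 0\<close> \<open>P \<ge> 0\<close> \<open>\<alpha> > 0\<close> by (intro divide_right_mono mult_right_mono) auto
    finally show ?thesis .
  qed
  have AB: "A (B (x - z)) = x - z"
    using xD z(1) subspace_diff[OF subspace_domain] by (simp add: inverse_operator_B)
  have "norm (A (B (x - z))) \<le> K * (E + P) * \<alpha> powr (- a / (2 * a + 2))"
  proof (rule interpolation[OF \<open>a > 0\<close> \<open>\<alpha> > 0\<close> _ _ pos])
    show "norm (spectral_calculus (\<lambda>t. \<bar>t\<bar> powr a) A (A (B (x - z)))) \<le> K * (E + P)"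
      using neg unfolding AB negative_norm_def negative_power_def .
  qed (use \<open>K \<ge> 1\<close> \<open>E \<ge> 0\<close> \<open>P \<ge> 0\<close> in simp)
  then show ?thesis unfolding AB total K_def .
qed

text \<open>For small \<open>\<alpha>\<close> the smoothed element is so close to the interior point
  \<open>xdag\<close> that it lies in \<open>DF\<close>. For larger \<open>\<alpha>\<close> the
  right-hand sides are bounded below by monotonicity, and \<open>xbar\<close> itself serves.\<close>

lemma (in bounded_below_self_adjoint) admissible_approximation:
  fixes xdag xbar w :: 'a and \<psi> :: "real \<Rightarrow> real"
  assumes "a > 0" and \<psi>: "index_function \<psi>" and sub: "sub_linear (\<lambda>t. \<psi> t powr (2 * a + 2))"
    and source: "xdag - xbar = index_operator \<psi> (negative_power D B (2 * a + 2)) w"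
    and xbar: "xbar \<in> DF \<inter> D" and "xdag \<in> interior DF"
  obtains C where "C > 0"
    "\<And>\<alpha>. \<alpha> > 0 \<Longrightarrow> \<exists>z \<in> DF \<inter> D. norm (z - xdag) \<le> C * \<psi> \<alpha>
      \<and> negative_norm D B a (z - xdag) \<le> C * \<psi> \<alpha> * \<alpha> powr (a / (2 * a + 2))
      \<and> norm (B (z - xbar)) \<le> C * \<psi> \<alpha> * \<alpha> powr (a / (2 * a + 2)) / sqrt \<alpha>"
proof -
  define q where "q = 2 * a + 2"
  have "q > 0" using \<open>a > 0\<close> by (simp add: q_def)
  have pos: "\<psi> t > 0" if "t > 0" for t using \<psi> that by (simp add: index_function_def)
  obtain C t0 where "C > 0" "t0 > 0" and smooth:
    "\<And>\<alpha>. 0 < \<alpha> \<Longrightarrow> \<alpha> \<le> t0 \<Longrightarrow> \<exists>v. norm (A v - (xdag - xbar)) \<le> C * \<psi> \<alpha>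
      \<and> norm (negative_power D B a (A v - (xdag - xbar))) \<le> C * \<psi> \<alpha> * \<alpha> powr (a / q)
      \<and> norm v \<le> C * \<psi> \<alpha> * \<alpha> powr (- 1 / q)"
    using smoothed_approximation[OF \<open>a > 0\<close> \<psi> sub, of w]
    unfolding source negative_power_def q_def by blast
  obtain \<rho> where "\<rho> > 0" "ball xdag \<rho> \<subseteq> DF"
    using \<open>xdag \<in> interior DF\<close> by (meson mem_interior)
  have "(\<psi> \<longlongrightarrow> 0) (at_right 0)" using \<psi> by (simp add: index_function_def)
  then have "\<forall>\<^sub>F \<alpha> in at_right 0. \<psi> \<alpha> < \<rho> / C"
    using \<open>\<rho> > 0\<close> \<open>C > 0\<close> by (intro order_tendstoD) auto
  then obtain t1 where "t1 > 0" and t1: "\<And>\<alpha>. 0 < \<alpha> \<Longrightarrow> \<alpha> < t1 \<Longrightarrow> \<psi> \<alpha> < \<rho> / C"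
    unfolding eventually_at_right_field by auto
  \<comment> \<open>Halving \<open>t1\<close> gives the strict inequality
    \<open>\<alpha> < t1\<close> for all \<open>\<alpha> \<le> \<alpha>0\<close>.\<close>
  define \<alpha>0 where "\<alpha>0 = min t0 (t1 / 2)"
  have "\<alpha>0 > 0" using \<open>t0 > 0\<close> \<open>t1 > 0\<close> by (simp add: \<alpha>0_def)
  \<comment> \<open>Raised until \<open>xbar\<close> satisfies the two estimates at
    \<open>\<alpha>0\<close>; its third one is trivial.\<close>
  define C' where "C' = max C (max (norm (xbar - xdag) / \<psi> \<alpha>0)
    (negative_norm D B a (xbar - xdag) / (\<psi> \<alpha>0 * \<alpha>0 powr (a / q))))"
  have C': "C \<le> C'" "norm (xbar - xdag) / \<psi> \<alpha>0 \<le> C'"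
    "negative_norm D B a (xbar - xdag) / (\<psi> \<alpha>0 * \<alpha>0 powr (a / q)) \<le> C'"
    by (simp_all add: C'_def)
  have "\<exists>z \<in> DF \<inter> D. norm (z - xdag) \<le> C' * \<psi> \<alpha>
      \<and> negative_norm D B a (z - xdag) \<le> C' * \<psi> \<alpha> * \<alpha> powr (a / q)
      \<and> norm (B (z - xbar)) \<le> C' * \<psi> \<alpha> * \<alpha> powr (a / q) / sqrt \<alpha>" if "\<alpha> > 0" for \<alpha>
  proof (cases "\<alpha> \<le> \<alpha>0")
    case True
    then have "\<alpha> \<le> t0" "\<alpha> < t1" using \<open>\<alpha> > 0\<close> by (auto simp: \<alpha>0_def)
    obtain v where v: "norm (A v - (xdag - xbar)) \<le> C * \<psi> \<alpha>"
      "norm (negative_power D B a (A v - (xdag - xbar))) \<le> C * \<psi> \<alpha> * \<alpha> powr (a / q)"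
      "norm v \<le> C * \<psi> \<alpha> * \<alpha> powr (- 1 / q)"
      using smooth[OF \<open>\<alpha> > 0\<close> \<open>\<alpha> \<le> t0\<close>] by blast
    have mono: "C * \<psi> \<alpha> * s \<le> C' * \<psi> \<alpha> * s" if "s \<ge> 0" for s
      using C'(1) pos[OF \<open>\<alpha> > 0\<close>] that by (intro mult_right_mono) auto
    have z: "xbar + A v - xdag = A v - (xdag - xbar)" by simp
    have "norm (xbar + A v - xdag) < \<rho>"
      using v(1) t1[OF \<open>\<alpha> > 0\<close> \<open>\<alpha> < t1\<close>] \<open>C > 0\<close> unfolding z by (simp add: field_simps)
    then have "xbar + A v \<in> DF"
      using \<open>ball xdag \<rho> \<subseteq> DF\<close> by (auto simp: dist_norm norm_minus_commute)
    moreover have "xbar + A v \<in> D"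
      using xbar inverse_operator_in_domain by (intro subspace_add[OF subspace_domain]) auto
    moreover have "norm (B (xbar + A v - xbar)) \<le> C' * \<psi> \<alpha> * \<alpha> powr (a / q) / sqrt \<alpha>"
    proof -
      \<comment> \<open>Puts the penalty estimate into the form \<open>P / sqrt \<alpha>\<close>
        with the same \<open>P\<close> that bounds the negative norm.\<close>
      have "- 1 / q = a / q - 1 / 2" using \<open>a > 0\<close> by (simp add: q_def field_simps)
      then have "\<alpha> powr (- 1 / q) = \<alpha> powr (a / q) / sqrt \<alpha>"
        using \<open>\<alpha> > 0\<close> by (simp add: powr_diff powr_half_sqrt)
      then show ?thesis
        using v(3) mono[of "\<alpha> powr (- 1 / q)"] \<open>\<alpha> > 0\<close> by (simp add: B_inverse_operator)
    qed
    moreover have "norm (xbar + A v - xdag) \<le> C' * \<psi> \<alpha>"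
      using v(1) mono[of 1] unfolding z by simp
    moreover have "negative_norm D B a (xbar + A v - xdag) \<le> C' * \<psi> \<alpha> * \<alpha> powr (a / q)"
      using v(2) mono[of "\<alpha> powr (a / q)"] unfolding z negative_norm_def by simp
    ultimately show ?thesis by blast
  next
    case False
    have "C' > 0" using C'(1) \<open>C > 0\<close> by simp
    have "\<psi> \<alpha>0 \<le> \<psi> \<alpha>" using \<psi> \<open>\<alpha>0 > 0\<close> False by (simp add: index_function_def mono_on_def)
    have "\<alpha>0 powr (a / q) \<le> \<alpha> powr (a / q)"
      using \<open>\<alpha>0 > 0\<close> False \<open>a > 0\<close> \<open>q > 0\<close> by (intro powr_mono2) auto
    have "norm (xbar - xdag) \<le> C' * \<psi> \<alpha>0"
      using C'(2) pos[OF \<open>\<alpha>0 > 0\<close>] by (simp add: pos_divide_le_eq)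
    also have "\<dots> \<le> C' * \<psi> \<alpha>" using \<open>\<psi> \<alpha>0 \<le> \<psi> \<alpha>\<close> \<open>C' > 0\<close> by simp
    finally have 1: "norm (xbar - xdag) \<le> C' * \<psi> \<alpha>" .
    have "negative_norm D B a (xbar - xdag) \<le> C' * (\<psi> \<alpha>0 * \<alpha>0 powr (a / q))"
      using C'(3) pos[OF \<open>\<alpha>0 > 0\<close>] \<open>\<alpha>0 > 0\<close> by (simp add: pos_divide_le_eq)
    also have "\<dots> \<le> C' * (\<psi> \<alpha> * \<alpha> powr (a / q))"
      using \<open>\<psi> \<alpha>0 \<le> \<psi> \<alpha>\<close> \<open>\<alpha>0 powr (a / q) \<le> \<alpha> powr (a / q)\<close> \<open>C' > 0\<close> pos[OF \<open>\<alpha>0 > 0\<close>]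
      by (intro mult_left_mono mult_mono) auto
    finally have 2: "negative_norm D B a (xbar - xdag) \<le> C' * \<psi> \<alpha> * \<alpha> powr (a / q)"
      by (simp add: mult.assoc)
    have "norm (B (xbar - xbar)) \<le> C' * \<psi> \<alpha> * \<alpha> powr (a / q) / sqrt \<alpha>"
      using \<open>C' > 0\<close> pos[OF \<open>\<alpha> > 0\<close>] \<open>\<alpha> > 0\<close> by (simp add: B_0)
    then show ?thesis using 1 2 xbar by blast
  qed
  then show ?thesis using that[of C'] C'(1) \<open>C > 0\<close> by (simp add: q_def)
qed

theorem theorem1:
  fixes F :: "'x::{real_inner, complete_space} \<Rightarrow> 'y::{real_inner, complete_space}"
    and DF DB :: "'x set" and B :: "'x \<Rightarrow> 'x"
    and xdag xbar w :: 'x and y :: 'y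
    and m a c\<^sub>a C\<^sub>a :: real and \<psi> :: "real \<Rightarrow> real"
  assumes "separable_space (euclidean :: 'x topology)" "infinite_dimensional TYPE('x)"
    and "separable_space (euclidean :: 'y topology)" "infinite_dimensional TYPE('y)"
    and "convex DF" "closed DF" "weakly_seq_continuous_on DF F"
    and "self_adjoint_on DB B" "unbounded_on DB B"
    and "m > 0" "\<forall>x\<in>DB. norm (B x) \<ge> m * norm x"
    and "xbar \<in> DF \<inter> DB"
    and "xdag \<in> interior DF" "F xdag = y"
    and "a > 0" "0 < c\<^sub>a" "c\<^sub>a \<le> C\<^sub>a"
    and "\<forall>x\<in>DF \<inter> DB. c\<^sub>a * negative_norm DB B a (x - xdag) \<le> norm (F x - F xdag)
                     \<and> norm (F x - F xdag) \<le> C\<^sub>a * negative_norm DB B a (x - xdag)"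
    and "index_function \<psi>" "sub_linear (\<lambda>t. \<psi> t powr (2 * a + 2))"
    and "xdag - xbar = index_operator \<psi> (negative_power DB B (2 * a + 2)) w"
  shows "\<exists>c\<^sub>1>0. \<forall>\<alpha>>0. \<forall>\<delta>\<ge>0. \<forall>yd. norm (y - yd) \<le> \<delta> \<longrightarrow>
           (\<forall>x. is_minimizer_on (DF \<inter> DB) (tikhonov F B xbar \<alpha> yd) x \<longrightarrow>
              (let K\<^sub>2 = max 1 (2 / c\<^sub>a); lam = 1 / K\<^sub>2 * \<alpha> powr (a / (2 * a + 2))
               in norm (x - xdag) \<le> c\<^sub>1 * \<psi> \<alpha> + \<delta> / lam))"
proof -
  have B: "bounded_below_self_adjoint DB B m"
    using assms(8,10,11) by unfold_locales auto
  obtain C where "C > 0" and approx: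
    "\<And>\<alpha>. \<alpha> > 0 \<Longrightarrow> \<exists>z \<in> DF \<inter> DB. norm (z - xdag) \<le> C * \<psi> \<alpha>
      \<and> negative_norm DB B a (z - xdag) \<le> C * \<psi> \<alpha> * \<alpha> powr (a / (2 * a + 2))
      \<and> norm (B (z - xbar)) \<le> C * \<psi> \<alpha> * \<alpha> powr (a / (2 * a + 2)) / sqrt \<alpha>"
    using bounded_below_self_adjoint.admissible_approximation[OF B assms(15,19,20,21,12,13)] by blast
  define K where "K = max 1 (2 / c\<^sub>a)"
  have "K \<ge> 1" by (simp add: K_def)
  \<comment> \<open>The first summand comes from \<open>z - xdag\<close>, the second from the
    noise-free part of the bound on \<open>x - z\<close>.\<close>
  define c where "c = C + K * ((C\<^sub>a + 2) * C)"
  have "norm (x - xdag) \<le> c * \<psi> \<alpha> + \<delta> / (1 / K * \<alpha> powr (a / (2 * a + 2)))"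
    if "\<alpha> > 0" and \<delta>: "norm (y - yd) \<le> \<delta>"
      and x: "is_minimizer_on (DF \<inter> DB) (tikhonov F B xbar \<alpha> yd) x" for \<alpha> \<delta> yd x
  proof -
    let ?p = "\<alpha> powr (a / (2 * a + 2))"
    obtain z where z: "z \<in> DF \<inter> DB" "norm (z - xdag) \<le> C * \<psi> \<alpha>"
      "negative_norm DB B a (z - xdag) \<le> C * \<psi> \<alpha> * ?p"
      "norm (B (z - xbar)) \<le> C * \<psi> \<alpha> * ?p / sqrt \<alpha>"
      using approx[OF \<open>\<alpha> > 0\<close>] by blast
    have "norm (x - z) \<le> K * ((C\<^sub>a + 2) * (C * \<psi> \<alpha> * ?p) + \<delta>) * \<alpha> powr (- a / (2 * a + 2))"
      unfolding K_def
      by (rule tikhonov_minimizer_error[OF B _ _ _ _ _ z(1,3,4) \<open>\<alpha> > 0\<close> _ x]) (use assms(12,14-18) \<delta> in auto)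
    also have "\<alpha> powr (- a / (2 * a + 2)) = 1 / ?p"
      using powr_minus_divide[of \<alpha> "a / (2 * a + 2)"] by simp
    \<comment> \<open>With \<open>P = C * \<psi> \<alpha> * ?p\<close> the powers of
      \<open>\<alpha>\<close> cancel in the first term, and the noise keeps exactly the factor
      \<open>K / ?p\<close>.\<close>
    also have "K * ((C\<^sub>a + 2) * (C * \<psi> \<alpha> * ?p) + \<delta>) * (1 / ?p)
        = K * ((C\<^sub>a + 2) * C) * \<psi> \<alpha> + \<delta> / (1 / K * ?p)"
      using \<open>\<alpha> > 0\<close> \<open>K \<ge> 1\<close> by (simp add: field_simps)
    finally show ?thesis
      using z(2) norm_triangle_ineq[of "x - z" "z - xdag"] by (simp add: c_def algebra_simps)
  qed
  moreover have "c > 0"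
    using \<open>C > 0\<close> \<open>K \<ge> 1\<close> assms(16,17) by (simp add: c_def add_pos_nonneg)
  ultimately show ?thesis unfolding Let_def K_def by blast
qed

end
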